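(* Let $G \in \mathfrak{T}^*$ be a graph that is not a cycle, and let $k$ be the number of cycles of $G$. Then there is an independent set (matching) $E_d$ of at most $k$ non-pendant edges of $G$ such that the multigraph $G + E_d$ has a $2$-liec.
   Context: The family $\mathfrak{T}^*$ is defined recursively: every cycle $C_n$ belongs to $\mathfrak{T}^*$; if $G \in \mathfrak{T}^*$, then every graph $G'$ obtained from $G$ by identifying a vertex $v \in V(G)$ of degree two which lies on a cycle of $G$ either with an end vertex of a (new, disjoint) path of positive length, or with an end vertex of a (new, disjoint) path whose other end vertex is identified with a vertex of a new (disjoint) cycle, belongs to $\mathfrak{T}^*$. An edge is pendant if one of its endvertices has degree one. For a graph $G$ and $E_d \subseteq E(G)$, $G + E_d$ is the multigraph obtained by replacing each edge of $E_d$ with two parallel edges. A (multi)graph is locally irregular if the two endvertices of every edge have different degrees (counting parallel edges with multiplicity). A $2$-liec (locally irregular $2$-edge coloring) of a multigraph is a coloring of its edges with at most two colors such that each color class induces a locally irregular submultigraph. *)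

theory Defs
  imports Main
begin

section \<open>Simple graphs, paths and cycles\<close>

text \<open>Edges are intended to be two-element subsets of the vertex set; all graphs built below
  satisfy this.\<close>

record 'v sgraph =
  verts :: "'v set"
  edges :: "'v set set"

definition degree :: "'v sgraph \<Rightarrow> 'v \<Rightarrow> nat" where
  "degree G v = card {e \<in> edges G. v \<in> e}"

definition pendant :: "'v sgraph \<Rightarrow> 'v set \<Rightarrow> bool" where
  "pendant G e \<longleftrightarrow> e \<in> edges G \<and> (\<exists>v\<in>e. degree G v = 1)"

definition graph_union :: "'v sgraph \<Rightarrow> 'v sgraph \<Rightarrow> 'v sgraph" where
  "graph_union G H = \<lparr>verts = verts G \<union> verts H, edges = edges G \<union> edges H\<rparr>"

definition subgraph :: "'v sgraph \<Rightarrow> 'v sgraph \<Rightarrow> bool" where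
  "subgraph H G \<longleftrightarrow> verts H \<subseteq> verts G \<and> edges H \<subseteq> edges G"

definition path_edges :: "'v list \<Rightarrow> 'v set set" where
  "path_edges p = {{p ! i, p ! Suc i} | i. Suc i < length p}"

text \<open>A list \<open>p\<close> of distinct vertices stands for the path visiting them in this order, of length
  \<open>length p - 1\<close> and with end vertices \<open>hd p\<close> and \<open>last p\<close>.\<close>

definition path_graph :: "'v list \<Rightarrow> 'v sgraph" where
  "path_graph p = \<lparr>verts = set p, edges = path_edges p\<rparr>"

definition cycle_graph :: "'v list \<Rightarrow> 'v sgraph" where
  "cycle_graph c = \<lparr>verts = set c, edges = insert {last c, hd c} (path_edges c)\<rparr>"

definition is_cycle :: "'v sgraph \<Rightarrow> bool" where
  "is_cycle C \<longleftrightarrow> (\<exists>c. distinct c \<and> 3 \<le> length c \<and> C = cycle_graph c)"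

text \<open>Cycles are counted as subgraphs, i.e. irrespective of starting vertex and orientation.\<close>

definition cycles :: "'v sgraph \<Rightarrow> 'v sgraph set" where
  "cycles G = {C. is_cycle C \<and> subgraph C G}"

definition matching :: "'v sgraph \<Rightarrow> 'v set set \<Rightarrow> bool" where
  "matching G M \<longleftrightarrow> M \<subseteq> edges G \<and> pairwise disjnt M"


section \<open>The family \<open>T_star\<close>\<close>

text \<open>Identifying a vertex \<open>v\<close> of \<open>G\<close> with an end vertex of a disjoint path is rendered by
  the union of \<open>G\<close> with a path that starts in \<open>v\<close> and otherwise avoids \<open>G\<close>, and similarly for
  the other end vertex of the path and the new cycle. As every choice of fresh vertices is
  allowed, the family is closed under renaming vertices. The connecting path in the third rule
  has two different end vertices, i.e. positive length, so that distinct cycles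
  are vertex-disjoint.\<close>

inductive_set T_star :: "'v sgraph set" where
  cycle:
    "is_cycle C \<Longrightarrow> C \<in> T_star"
| add_path:
    "G \<in> T_star \<Longrightarrow>
     v \<in> verts G \<Longrightarrow> degree G v = 2 \<Longrightarrow> (\<exists>C\<in>cycles G. v \<in> verts C) \<Longrightarrow>
     distinct p \<Longrightarrow> 2 \<le> length p \<Longrightarrow> hd p = v \<Longrightarrow> set p \<inter> verts G = {v} \<Longrightarrow>
     graph_union G (path_graph p) \<in> T_star"
| add_path_cycle:
    "G \<in> T_star \<Longrightarrow>
     v \<in> verts G \<Longrightarrow> degree G v = 2 \<Longrightarrow> (\<exists>C\<in>cycles G. v \<in> verts C) \<Longrightarrow>
     distinct p \<Longrightarrow> 2 \<le> length p \<Longrightarrow> hd p = v \<Longrightarrow> set p \<inter> verts G = {v} \<Longrightarrow>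
     is_cycle C' \<Longrightarrow> verts C' \<inter> verts G = {} \<Longrightarrow> verts C' \<inter> set p = {last p} \<Longrightarrow>
     graph_union (graph_union G (path_graph p)) C' \<in> T_star"


section \<open>Multigraphs and locally irregular edge colorings\<close>

record ('v, 'e) mgraph =
  mverts :: "'v set"
  medges :: "'e set"
  mends :: "'e \<Rightarrow> 'v set"

definition mdegree :: "('v, 'e) mgraph \<Rightarrow> 'v \<Rightarrow> nat" where
  "mdegree M v = card {e \<in> medges M. v \<in> mends M e}"

definition locally_irregular :: "('v, 'e) mgraph \<Rightarrow> bool" where
  "locally_irregular M \<longleftrightarrow>
     (\<forall>e\<in>medges M. \<forall>u v. mends M e = {u, v} \<longrightarrow> mdegree M u \<noteq> mdegree M v)"

definition edge_induced :: "('v, 'e) mgraph \<Rightarrow> 'e set \<Rightarrow> ('v, 'e) mgraph" where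
  "edge_induced M F = \<lparr>mverts = (\<Union>e\<in>F. mends M e), medges = F, mends = mends M\<rparr>"

definition is_liec :: "nat \<Rightarrow> ('v, 'e) mgraph \<Rightarrow> ('e \<Rightarrow> nat) \<Rightarrow> bool" where
  "is_liec k M c \<longleftrightarrow>
     c ` medges M \<subseteq> {..<k} \<and>
     (\<forall>i<k. locally_irregular (edge_induced M {e \<in> medges M. c e = i}))"

definition has_liec :: "nat \<Rightarrow> ('v, 'e) mgraph \<Rightarrow> bool" where
  "has_liec k M \<longleftrightarrow> (\<exists>c. is_liec k M c)"

text \<open>\<open>G + D\<close>: the edge \<open>(e, False)\<close> is the original copy of \<open>e\<close>, and \<open>(e, True)\<close> is the
  additional parallel copy, present for \<open>e \<in> D\<close>. The two copies may receive different colors.\<close>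

definition double_edges :: "'v sgraph \<Rightarrow> 'v set set \<Rightarrow> ('v, 'v set \<times> bool) mgraph" where
  "double_edges G D =
     \<lparr>mverts = verts G, medges = edges G \<times> {False} \<union> D \<times> {True}, mends = fst\<rparr>"

end

theory Submission
  imports Defs
begin

text \<open>
  We double one edge on each cycle. As distinct cycles are disjoint, the doubled
  edges form a matching of non-pendant edges, so only the coloring is at issue.

  A piece (a path, possibly ending in a cycle) hung from a cycle vertex \<open>v\<close> affects the rest of
  the graph only through the degree \<open>d\<close>, in the color of the connecting edge, of the root of the
  piece: the degree of \<open>v\<close> in that color must differ from \<open>d\<close>. Up to exchanging the colors of
  the piece, it is thus replaced by a half-edge at \<open>v\<close> labelled \<open>d\<close>. Extending a piece by one
  edge at its root exchanges \<open>d = 1\<close> and \<open>d = 2\<close>. So \<open>G\<close> is colored by induction along its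
  construction, for all labellings of its cycle vertices of degree two, once cycles with
  half-edges can be colored.

  On a cycle, start from a labelled vertex, double its edge to the next vertex, and color the
  remaining edges one by one. An edge carries the pair of its color and the degree in this color of
  the vertex it leaves. Either some start closes up with every end, or one of the starts \<open>(c, 1)\<close>
  and \<open>(c, 3)\<close> does with a common end that both can reach.
\<close>

section \<open>Coloring a labelled cycle\<close>

text \<open>Label 0 stands for no half-edge, and a half-edge labelled 1 or 2 forbids that degree in its color.
  Label 3 bounds the degree by 2; it is used for the root of a piece, whose degree can then serve
  as a label where the piece is hung.\<close>

definition label_ok :: "nat \<Rightarrow> nat \<Rightarrow> bool" where
  "label_ok l d \<longleftrightarrow> (l = 1 \<longrightarrow> d \<noteq> 1) \<and> (l = 2 \<longrightarrow> d \<noteq> 2) \<and> (l = 3 \<longrightarrow> d \<le> 2)"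

definition half :: "nat \<Rightarrow> bool \<Rightarrow> bool \<Rightarrow> nat" where
  "half l p c = (if l \<noteq> 0 \<and> p = c then 1 else 0)"

text \<open>In a state \<open>(c, s)\<close>, \<open>s\<close> is the \<open>c\<close>-degree of the start vertex of the current edge of color
  \<open>c\<close>. A step passes a vertex labelled \<open>l\<close>, with \<open>p\<close> the color of its half-edge.\<close>

fun step :: "nat \<Rightarrow> bool \<times> nat \<Rightarrow> bool \<times> nat \<Rightarrow> bool" where
  "step l (c, s) (c', s') \<longleftrightarrow> (\<exists>p.
     of_bool (c' = c) + 1 + half l p c \<noteq> s \<and> s' = 1 + of_bool (c = c') + half l p c' \<and>
     (l \<noteq> 0 \<longrightarrow> label_ok l (of_bool (c' = p) + of_bool (c = p) + 1)))"

fun run :: "nat list \<Rightarrow> bool \<times> nat \<Rightarrow> bool \<times> nat \<Rightarrow> bool" where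
  "run [] a b \<longleftrightarrow> a = b"
| "run (l # w) a b \<longleftrightarrow> (\<exists>x. step l a x \<and> run w x b)"

text \<open>The doubled edge, with \<open>k\<close> copies of color \<open>True\<close>, joins the vertices labelled \<open>l0\<close> and \<open>l1\<close>.
  The next edge leaves \<open>l1\<close> in state \<open>(True, s1)\<close>, and the last edge arrives at \<open>l0\<close> in state
  \<open>(c, s)\<close>.\<close>

fun closes :: "nat \<Rightarrow> nat \<Rightarrow> nat \<Rightarrow> bool \<times> nat \<Rightarrow> bool" where
  "closes l0 l1 s1 (c, s) \<longleftrightarrow> (\<exists>k\<in>{0, 1, 2}. \<exists>p0 p1.
     let a = (\<lambda>x. if x then k else 2 - k);
         d0 = (\<lambda>x. a x + of_bool (c = x) + half l0 p0 x);
         d1 = (\<lambda>x. of_bool (True = x) + a x + half l1 p1 x)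
     in s \<noteq> d0 c \<and> s1 = d1 True \<and> (\<forall>x. 0 < a x \<longrightarrow> d0 x \<noteq> d1 x) \<and>
        (l0 \<noteq> 0 \<longrightarrow> label_ok l0 (d0 p0)) \<and> (l1 \<noteq> 0 \<longrightarrow> label_ok l1 (d1 p1)))"

section \<open>Runs along the labelled vertices of a cycle\<close>

lemma less_4: "l \<le> 3 \<longleftrightarrow> l = 0 \<or> l = 1 \<or> l = 2 \<or> l = (3::nat)"
  by auto

declare step.simps [simp del] closes.simps [simp del]

lemmas transfer_simps = step.simps closes.simps half_def label_ok_def ex_bool_eq all_bool_eq Let_def

text \<open>A coloring can always be continued: the free colors of the next edge and of the
  half-edge suffice to avoid degree \<open>s\<close> and to respect the label. Without a half-edge,
  going on in \<open>c\<close> gives the vertex degree 2 in \<open>c\<close>, and switching gives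
  degree 1.\<close>

lemma step_total:
  assumes "l \<le> 3" "s \<in> {1, 2, 3}"
  shows "\<exists>c' s'. step l (c, s) (c', s') \<and> s' \<in> {1, 2, 3}"
proof -
  \<comment> \<open>The witnesses fix the color of the next edge and its degree; the half-edge color
    is found by simplification, as \<open>ex_bool_eq\<close> splits it into two cases.\<close>
  define c' where "c' = (if l = 0 \<and> s \<noteq> 2 \<or> l = 2 \<or> l = 3 \<and> s \<noteq> 2 then c else \<not> c)"
  define s' :: nat where "s' = (if l = 0 then if s = 2 then 1 else 2 else if l = 1 then if s = 1 then 1 else 2
    else if l = 2 then if s = 3 then 2 else 3 else 2)"
  have "step l (c, s) (c', s')"
    using assms unfolding less_4 by (cases c) (elim disjE insertE; simp add: c'_def s'_def transfer_simps)+
  moreover have "s' \<in> {1, 2, 3}" by (simp add: s'_def)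
  ultimately show ?thesis by blast
qed

lemma run_total:
  assumes "\<forall>l\<in>set w. l \<le> 3" "s \<in> {1, 2, 3}"
  shows "\<exists>c' s'. run w (c, s) (c', s') \<and> s' \<in> {1, 2, 3}"
  using assms
proof (induction w arbitrary: c s)
  case (Cons l w)
  from Cons.prems obtain c' s' where "step l (c, s) (c', s')" "s' \<in> {1, 2, 3}"
    using step_total[of l s c] by auto
  moreover obtain c'' s'' where "run w (c', s') (c'', s'')" "s'' \<in> {1, 2, 3}"
    using Cons.IH[of s' c'] Cons.prems(1) \<open>s' \<in> {1, 2, 3}\<close> by auto
  ultimately show ?case unfolding run.simps by blast
qed auto

text \<open>Giving the first vertex degree 2 in color \<open>True\<close> avoids both 1 and 3, and
  every label permits this. From there on the two runs are the same.\<close>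

lemma run_merge:
  assumes "w \<noteq> []" "\<forall>l\<in>set w. l \<le> 3"
  shows "\<exists>c s. run w (True, 1) (c, s) \<and> run w (True, 3) (c, s) \<and> s \<in> {1, 2, 3}"
proof -
  obtain l w' where w: "w = l # w'" using assms(1) by (cases w) auto
  define c where "c \<longleftrightarrow> l \<noteq> 1"
  define s :: nat where "s = (if l = 1 then 1 else 2)"
  have "l \<le> 3" using assms w by auto
  then have "step l (True, 1) (c, s)" "step l (True, 3) (c, s)"
    unfolding less_4 by (elim disjE; simp add: c_def s_def transfer_simps)+
  moreover have "s \<in> {1, 2, 3}" by (simp add: s_def)
  then obtain c' s' where "run w' (c, s) (c', s')" "s' \<in> {1, 2, 3}"
    using run_total[of w' s c] assms(2) w by auto
  ultimately show ?thesis unfolding w run.simps by blast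
qed

text \<open>Both copies of the doubled edge and the half-edge at \<open>l0\<close> can take the
  color \<open>c\<close> of the last edge. This end then has degree 4 in \<open>c\<close>, more than
  any \<open>s\<close> and more than the other end, whose half-edge, if any, is colored
  \<open>False\<close>. The start is 3 or 1 according to whether the two copies have color
  \<open>True\<close>.\<close>

lemma closes_merge:
  assumes "(l0, l1) \<in> {(1, 0), (2, 0), (2, 2)}" "s \<in> {1, 2, 3}"
  shows "closes l0 l1 (if c then 3 else 1) (c, s)"
proof -
  have "\<forall>(l0, l1)\<in>{(1, 0), (2, 0), (2, 2)}. \<forall>s\<in>{1, 2, 3}. \<forall>c.
          closes l0 l1 (if c then 3 else 1) (c, s)"
    by (simp add: transfer_simps)
  then show ?thesis using assms by blast
qed

text \<open>One start serves every end, because the split \<open>k\<close> of the doubled edge and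
  both half-edge colors may still depend on the end. The finitely many cases are checked by
  computation.\<close>

lemma closes_any:
  assumes "(l0, l1) \<in> {(1, 1), (1, 2), (1, 3), (2, 1), (2, 3)}" "s \<in> {1, 2, 3}"
  shows "closes l0 l1 (if l1 = 2 then 3 else 2) (c, s)"
proof -
  have "\<forall>(l0, l1)\<in>{(1, 1), (1, 2), (1, 3), (2, 1), (2, 3)}. \<forall>s\<in>{1, 2, 3}. \<forall>c.
          closes l0 l1 (if l1 = 2 then 3 else 2) (c, s)"
    by (simp add: transfer_simps)
  then show ?thesis using assms by blast
qed

lemma labelled_closes:
  assumes "l0 \<in> {1, 2}" "l1 \<le> 3" "w \<noteq> []" "\<forall>l\<in>set w. l \<le> 3"
  shows "\<exists>s b. run w (True, s) b \<and> closes l0 l1 s b"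
proof (cases "(l0, l1) \<in> {(1, 0), (2, 0), (2, 2)}")
  case True
  obtain c s where "run w (True, 1) (c, s)" "run w (True, 3) (c, s)" "s \<in> {1, 2, 3}"
    using run_merge[OF assms(3,4)] by blast
  then show ?thesis using closes_merge[OF True, of s c] by (metis (full_types))
next
  case False
  then have l: "(l0, l1) \<in> {(1, 1), (1, 2), (1, 3), (2, 1), (2, 3)}"
    using assms(1,2) unfolding less_4 by blast
  have "(if l1 = 2 then 3 else 2 :: nat) \<in> {1, 2, 3}" by simp
  from run_total[OF assms(4) this, of True]
  obtain c s where "run w (True, if l1 = 2 then 3 else 2) (c, s)" "s \<in> {1, 2, 3}" by blast
  then show ?thesis using closes_any[OF l, of s c] by blast
qed

text \<open>Without labels each of the four states has a unique successor, and they form the 4-cycle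
  \<open>(True, 1)\<close>, \<open>(True, 2)\<close>, \<open>(False, 1)\<close>,
  \<open>(False, 2)\<close>. The alternatives are the residues of \<open>j\<close> modulo 4.\<close>

lemma unlabelled_run:
  "\<exists>a0 a1 a2 a3. run (replicate j 0) (True, 1) a0 \<and> run (replicate j 0) (True, 2) a1 \<and>
     run (replicate j 0) (False, 1) a2 \<and> run (replicate j 0) (False, 2) a3 \<and>
     (a0, a1, a2, a3) \<in> {((True, 1), (True, 2), (False, 1), (False, 2)),
       ((True, 2), (False, 1), (False, 2), (True, 1)),
       ((False, 1), (False, 2), (True, 1), (True, 2)),
       ((False, 2), (True, 1), (True, 2), (False, 1))}"
proof (induction j)
  case (Suc j)
  have "step 0 (True, 1) (True, 2)" "step 0 (True, 2) (False, 1)"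
    "step 0 (False, 1) (False, 2)" "step 0 (False, 2) (True, 1)"
    by (auto simp: transfer_simps)
  with Suc show ?case
    unfolding replicate_Suc run.simps by blast
qed auto

text \<open>If only the root is labelled, the doubled edge is the one that ends at a neighbor of the root.\<close>

lemma unlabelled_closes:
  "\<exists>s b. run (3 # replicate j 0) (True, s) b \<and> closes 0 0 s b"
proof -
  \<comment> \<open>These first steps and the closing ends below cover all four residues: start 1
    reaches an end of color \<open>False\<close> in the first three, and start 2 reaches
    \<open>(False, 1)\<close> in the last.\<close>
  have s: "step 3 (True, 1) (True, 2)" "step 3 (True, 1) (False, 1)" "step 3 (True, 2) (False, 2)"
    by (auto simp: transfer_simps)
  have "closes 0 0 1 (False, 1)" "closes 0 0 1 (False, 2)" "closes 0 0 2 (False, 1)"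
    by (auto simp: transfer_simps)
  with s unlabelled_run[of j] show ?thesis
    unfolding run.simps by blast
qed

text \<open>Edge \<open>i\<close> joins the vertices \<open>i\<close> and \<open>i + 1\<close>, and edge 0 is the doubled one.\<close>

definition cycle_labelling_ok :: "nat list \<Rightarrow> bool" where
  "cycle_labelling_ok ls \<longleftrightarrow> (\<exists>W p. let n = length ls;
     d = (\<lambda>c i. W c i + W c (if i = 0 then n - 1 else i - 1) + half (ls ! i) (p i) c) in
     (\<forall>i<n. W True i + W False i = (if i = 0 then 2 else 1)) \<and>
     (\<forall>i<n. \<forall>c. 0 < W c i \<longrightarrow> d c i \<noteq> d c (if Suc i = n then 0 else Suc i)) \<and>
     (\<forall>i<n. ls ! i \<noteq> 0 \<longrightarrow> label_ok (ls ! i) (d (p i) i)))"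

section \<open>From runs to edge multiplicities on the closed cycle\<close>

lemma run_states:
  assumes "run w a b"
  shows "\<exists>f. f 0 = a \<and> f (length w) = b \<and> (\<forall>i<length w. step (w ! i) (f i) (f (Suc i)))"
  using assms
proof (induction w arbitrary: a)
  case (Cons l w)
  then obtain x where x: "step l a x" "run w x b" by auto
  then obtain f where f: "f 0 = x" "f (length w) = b" "\<forall>i<length w. step (w ! i) (f i) (f (Suc i))"
    using Cons.IH by blast
  define g where "g i = (case i of 0 \<Rightarrow> a | Suc j \<Rightarrow> f j)" for i
  have "step ((l # w) ! i) (g i) (g (Suc i))" if "i < length (l # w)" for i
    using that f x by (cases i) (auto simp: g_def)
  then have "g 0 = a \<and> g (length (l # w)) = b \<and>
      (\<forall>i<length (l # w). step ((l # w) ! i) (g i) (g (Suc i)))"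
    using f by (simp add: g_def)
  then show ?case by blast
qed auto

lemma cycle_labelling_okI:
  assumes "run w (True, s) b" "closes l0 l1 s b"
  shows "cycle_labelling_ok (l0 # l1 # w)"
proof -
  define m where "m = length w"
  obtain f where f: "f 0 = (True, s)" "f m = b" "\<forall>i<m. step (w ! i) (f i) (f (Suc i))"
    using run_states[OF assms(1)] unfolding m_def by blast
  define col where "col i = fst (f i)" for i
  define sg where "sg i = snd (f i)" for i
  have feq: "f i = (col i, sg i)" for i by (simp add: col_def sg_def)
  obtain q where q: "\<And>i. i < m \<Longrightarrow>
     of_bool (col (Suc i) = col i) + 1 + half (w ! i) (q i) (col i) \<noteq> sg i \<and>
     sg (Suc i) = 1 + of_bool (col i = col (Suc i)) + half (w ! i) (q i) (col (Suc i)) \<and>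
     (w ! i \<noteq> 0 \<longrightarrow> label_ok (w ! i) (of_bool (col (Suc i) = q i) + of_bool (col i = q i) + 1))"
    using f(3) unfolding feq step.simps by metis
  have start: "col 0 = True" "sg 0 = s" using f(1) by (auto simp: col_def sg_def)
  have "closes l0 l1 s (col m, sg m)" using assms(2) f(2) feq by metis
  then obtain k p0 p1 where kp: "k \<in> {0, 1, 2::nat}"
    "let a = (\<lambda>x. if x then k else 2 - k);
         d0 = (\<lambda>x. a x + of_bool (col m = x) + half l0 p0 x);
         d1 = (\<lambda>x. of_bool (True = x) + a x + half l1 p1 x)
     in sg m \<noteq> d0 (col m) \<and> s = d1 True \<and> (\<forall>x. 0 < a x \<longrightarrow> d0 x \<noteq> d1 x) \<and>
        (l0 \<noteq> 0 \<longrightarrow> label_ok l0 (d0 p0)) \<and> (l1 \<noteq> 0 \<longrightarrow> label_ok l1 (d1 p1))"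
    unfolding closes.simps by blast
  define a where "a x = (if x then k else 2 - k)" for x
  define d0 where "d0 x = a x + of_bool (col m = x) + half l0 p0 x" for x
  define d1 where "d1 x = of_bool (True = x) + a x + half l1 p1 x" for x
  have cl: "sg m \<noteq> d0 (col m)" "s = d1 True" "\<And>x. 0 < a x \<Longrightarrow> d0 x \<noteq> d1 x"
    "l0 \<noteq> 0 \<Longrightarrow> label_ok l0 (d0 p0)" "l1 \<noteq> 0 \<Longrightarrow> label_ok l1 (d1 p1)"
    using kp(2) unfolding Let_def a_def d0_def d1_def by auto
  \<comment> \<open>State \<open>f j\<close> belongs to edge \<open>Suc j\<close>, hence the shifts:
    edge 0 is the doubled one, vertices 0 and 1 are labelled \<open>l0\<close> and
    \<open>l1\<close>, and vertex \<open>Suc (Suc j)\<close> is labelled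
    \<open>w ! j\<close>.\<close>
  define W where "W c i = (case i of 0 \<Rightarrow> a c | Suc j \<Rightarrow> of_bool (col j = c))" for c i
  define p where "p i = (case i of 0 \<Rightarrow> p0 | Suc 0 \<Rightarrow> p1 | Suc (Suc j) \<Rightarrow> q j)" for i
  define ls where "ls = l0 # l1 # w"
  define n where "n = length ls"
  have n: "n = Suc (Suc m)" by (simp add: n_def ls_def m_def)
  define d where "d c i = W c i + W c (if i = 0 then n - 1 else i - 1) + half (ls ! i) (p i) c" for c i
  have d_0: "d c 0 = d0 c" for c
    by (simp add: d_def W_def d0_def n p_def ls_def)
  have d_1: "d c (Suc 0) = d1 c" for c
    by (simp add: d_def W_def d1_def p_def ls_def start)
  have d_2: "d c (Suc (Suc j)) = of_bool (col (Suc j) = c) + of_bool (col j = c) + half (w ! j) (q j) c" for c j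
    by (simp add: d_def W_def p_def ls_def)
  \<comment> \<open>The degree recorded in a state is the true degree of the vertex its edge leaves;
    for the edge after the doubled one this is \<open>s = d1 True\<close>.\<close>
  have sg: "sg i = d (col i) (Suc i)" if "i \<le> m" for i
  proof (cases i)
    case 0
    then show ?thesis using cl(2) start by (simp add: d_1)
  next
    case (Suc j)
    then show ?thesis using q[of j] that by (simp add: d_2)
  qed
  have 1: "W True i + W False i = (if i = 0 then 2 else 1)" for i
    using kp(1) by (auto simp: W_def a_def split: nat.split)
  have 2: "d c i \<noteq> d c (if Suc i = n then 0 else Suc i)" if "i < n" "0 < W c i" for i c
  proof (cases i)
    case 0
    then show ?thesis using that cl(3)[of c] n by (simp add: d_0 d_1 W_def)
  next
    case (Suc j)
    then have c: "c = col j" and "j \<le> m" using that n by (auto simp: W_def)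
    \<comment> \<open>Only the last edge returns to vertex 0, where the closing condition takes the
      place of a step.\<close>
    show ?thesis
    proof (cases "j = m")
      case True
      then show ?thesis using cl(1) sg[of j] c Suc n by (simp add: d_0)
    next
      case False
      then have "j < m" using \<open>j \<le> m\<close> by simp
      then have "d c (Suc j) \<noteq> d c (Suc (Suc j))"
        using q[of j] sg[of j] unfolding c d_2 by simp
      then show ?thesis using \<open>j < m\<close> by (simp add: Suc n)
    qed
  qed
  have 3: "label_ok (ls ! i) (d (p i) i)" if i: "i < n" "ls ! i \<noteq> 0" for i
  proof -
    consider "i = 0" | "i = Suc 0" | j where "i = Suc (Suc j)" "j < m"
      using i(1) n by (cases i; cases "i - 1") auto
    then show ?thesis
    proof cases
      case 3
      then show ?thesis using i q[of j] by (auto simp: ls_def p_def d_2 half_def)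
    qed (use i cl(4,5) in \<open>auto simp: ls_def p_def d_0 d_1\<close>)
  qed
  show ?thesis
    unfolding cycle_labelling_ok_def ls_def[symmetric] n_def[symmetric] Let_def
    by (rule exI[of _ W], rule exI[of _ p]) (use 1 2 3 in \<open>auto simp: d_def\<close>)
qed

section \<open>Colorings with half-edges\<close>

text \<open>\<open>W c e\<close> is the number of copies of the edge \<open>e\<close> of color \<open>c\<close>, and \<open>h c v\<close> the number of
  half-edges of color \<open>c\<close> at \<open>v\<close>.\<close>

definition wdeg :: "'v sgraph \<Rightarrow> (bool \<Rightarrow> 'v set \<Rightarrow> nat) \<Rightarrow> (bool \<Rightarrow> 'v \<Rightarrow> nat) \<Rightarrow> bool \<Rightarrow> 'v \<Rightarrow> nat" where
  "wdeg G W h c v = (\<Sum>e\<in>{e \<in> edges G. v \<in> e}. W c e) + h c v"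

text \<open>Degree at least 2 at the ends of doubled edges keeps these non-pendant, and it persists
  when further edges are attached.\<close>

definition valid :: "'v sgraph \<Rightarrow> 'v set set \<Rightarrow> (bool \<Rightarrow> 'v set \<Rightarrow> nat) \<Rightarrow> (bool \<Rightarrow> 'v \<Rightarrow> nat) \<Rightarrow> bool" where
  "valid G D W h \<longleftrightarrow> matching G D \<and> (\<forall>e\<in>D. \<forall>v\<in>e. 2 \<le> degree G v) \<and>
     (\<forall>e\<in>edges G. W True e + W False e = (if e \<in> D then 2 else 1)) \<and>
     (\<forall>u v c. {u, v} \<in> edges G \<longrightarrow> 0 < W c {u, v} \<longrightarrow> wdeg G W h c u \<noteq> wdeg G W h c v)"

definition cyc_edge :: "'v list \<Rightarrow> nat \<Rightarrow> 'v set" where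
  "cyc_edge c i = {c ! i, c ! (if Suc i = length c then 0 else Suc i)}"

lemma cycle_edges:
  assumes "c \<noteq> []"
  shows "edges (cycle_graph c) = cyc_edge c ` {..<length c}"
proof -
  have "path_edges c = cyc_edge c ` {..<length c - 1}"
    unfolding path_edges_def cyc_edge_def image_def by (auto intro!: exI bexI)
  moreover have "{last c, hd c} = cyc_edge c (length c - 1)"
    using assms by (auto simp: cyc_edge_def last_conv_nth hd_conv_nth)
  moreover have "{..<length c} = insert (length c - 1) {..<length c - 1}"
    using assms by (cases c) auto
  ultimately show ?thesis by (simp add: cycle_graph_def)
qed

lemma cyc_edge_inj:
  assumes "distinct c" "3 \<le> length c"
  shows "inj_on (cyc_edge c) {..<length c}"
proof (rule inj_onI)
  fix i j assume ij: "i \<in> {..<length c}" "j \<in> {..<length c}" "cyc_edge c i = cyc_edge c j"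
  moreover have "c \<noteq> []" using assms by auto
  ultimately show "i = j"
    using assms by (auto simp: cyc_edge_def doubleton_eq_iff nth_eq_iff_index_eq split: if_splits)
qed

lemma cycle_edges_at:
  assumes "distinct c" "3 \<le> length c" "i < length c"
  shows "{e \<in> edges (cycle_graph c). c ! i \<in> e} =
    {cyc_edge c i, cyc_edge c (if i = 0 then length c - 1 else i - 1)}"
proof -
  have "c \<noteq> []" using assms by auto
  have "c ! i \<in> cyc_edge c j \<longleftrightarrow> j = i \<or> j = (if i = 0 then length c - 1 else i - 1)"
    if "j < length c" for j
    using assms that \<open>c \<noteq> []\<close> by (auto simp: cyc_edge_def nth_eq_iff_index_eq split: if_splits)
  then show ?thesis
    using assms \<open>c \<noteq> []\<close> by (auto simp: cycle_edges)
qed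

text \<open>The multiplicities given by indices are carried over to the edges and vertices of the
  graph; the only doubled edge is \<open>cyc_edge c 0\<close>.\<close>

lemma cycle_valid:
  assumes c: "distinct c" "3 \<le> length c" and label_ok: "cycle_labelling_ok (map L c)"
  shows "\<exists>D W h. valid (cycle_graph c) D W h \<and> card D \<le> 1 \<and>
    (\<forall>v\<in>set c. \<exists>x. (\<forall>y. h y v = half (L v) x y) \<and>
       (L v \<noteq> 0 \<longrightarrow> label_ok (L v) (wdeg (cycle_graph c) W h x v)))"
proof -
  let ?G = "cycle_graph c"
  define n where "n = length c"
  define pre where "pre i = (if i = 0 then n - 1 else i - 1)" for i
  define nxt where "nxt i = (if Suc i = n then 0 else Suc i)" for i
  obtain w p where wp:
    "\<And>i. i < n \<Longrightarrow> w True i + w False i = (if i = 0 then 2 else 1::nat)"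
    "\<And>i x. i < n \<Longrightarrow> 0 < w x i \<Longrightarrow>
       w x i + w x (pre i) + half (L (c ! i)) (p i) x \<noteq>
       w x (nxt i) + w x (pre (nxt i)) + half (L (c ! nxt i)) (p (nxt i)) x"
    "\<And>i. i < n \<Longrightarrow> L (c ! i) \<noteq> 0 \<Longrightarrow>
       label_ok (L (c ! i)) (w (p i) i + w (p i) (pre i) + half (L (c ! i)) (p i) (p i))"
  proof -
    from label_ok[unfolded cycle_labelling_ok_def] obtain w p where "let n = length (map L c);
       d = (\<lambda>x i. w x i + w x (if i = 0 then n - 1 else i - 1) + half (map L c ! i) (p i) x) in
       (\<forall>i<n. w True i + w False i = (if i = 0 then 2 else 1)) \<and>
       (\<forall>i<n. \<forall>x. 0 < w x i \<longrightarrow> d x i \<noteq> d x (if Suc i = n then 0 else Suc i)) \<and>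
       (\<forall>i<n. map L c ! i \<noteq> 0 \<longrightarrow> label_ok (map L c ! i) (d (p i) i))"
      by (elim exE)
    note * = this[unfolded Let_def length_map, folded n_def, folded pre_def nxt_def]
    have m: "map L c ! i = L (c ! i)" if "i < n" for i using that by (simp add: n_def)
    have nn: "nxt i < n" if "i < n" for i using that by (auto simp: nxt_def)
    show ?thesis
    proof (rule that[of w p])
      show "w True i + w False i = (if i = 0 then 2 else 1)" if "i < n" for i
        using * that by blast
      show "w x i + w x (pre i) + half (L (c ! i)) (p i) x \<noteq>
         w x (nxt i) + w x (pre (nxt i)) + half (L (c ! nxt i)) (p (nxt i)) x"
        if "i < n" "0 < w x i" for i x
        using *[THEN conjunct2, THEN conjunct1, rule_format, OF that]
        unfolding m[OF that(1)] m[OF nn[OF that(1)]] .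
      show "label_ok (L (c ! i)) (w (p i) i + w (p i) (pre i) + half (L (c ! i)) (p i) (p i))"
        if "i < n" "L (c ! i) \<noteq> 0" for i
        using *[THEN conjunct2, THEN conjunct2, rule_format, of i] that
        unfolding m[OF that(1)] by blast
    qed
  qed
  have E: "edges ?G = cyc_edge c ` {..<n}" using cycle_edges[of c] c unfolding n_def by fastforce
  have inj: "inj_on (cyc_edge c) {..<n}" using cyc_edge_inj[OF c] by (simp add: n_def)
  \<comment> \<open>An edge or a vertex determines its index, by injectivity of
    \<open>cyc_edge c\<close> and distinctness of \<open>c\<close>.\<close>
  define W where "W x e = w x (the_inv_into {..<n} (cyc_edge c) e)" for x e
  have W: "W x (cyc_edge c i) = w x i" if "i < n" for x i
    using that inj by (simp add: W_def the_inv_into_f_f)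
  define ix where "ix = the_inv_into {..<n} ((!) c)"
  have ix: "ix (c ! i) = i" if "i < n" for i
    unfolding ix_def using that c by (intro the_inv_into_f_f) (auto simp: n_def inj_on_nth)
  define h where "h x v = half (L v) (p (ix v)) x" for x v
  have pre: "pre i < n" "pre i \<noteq> i" "nxt i < n" "pre (nxt i) = i" if "i < n" for i
    using that c by (auto simp: pre_def nxt_def n_def)
  have at: "{e \<in> edges ?G. c ! i \<in> e} = {cyc_edge c i, cyc_edge c (pre i)}" if "i < n" for i
    using cycle_edges_at[OF c, of i] that by (simp add: n_def pre_def)
  have ne: "cyc_edge c i \<noteq> cyc_edge c (pre i)" if "i < n" for i
    using inj pre[OF that] that by (auto dest: inj_onD)
  have deg: "wdeg ?G W h x (c ! i) = w x i + w x (pre i) + half (L (c ! i)) (p i) x" if "i < n" for x i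
    unfolding wdeg_def at[OF that] using ne[OF that] W pre[OF that] that by (simp add: h_def ix)
  have deg2: "degree ?G (c ! i) = 2" if "i < n" for i
    unfolding degree_def at[OF that] using ne[OF that] by simp
  define D where "D = {cyc_edge c 0}"
  have n0: "0 < n" using c n_def by auto
  have valid: "valid ?G D W h"
    unfolding valid_def
  proof (intro conjI ballI allI impI)
    show "matching ?G D" using n0 E by (auto simp: matching_def D_def)
  next
    fix e v assume "e \<in> D" "v \<in> e"
    then have "v = c ! 0 \<or> v = c ! nxt 0" by (auto simp: D_def cyc_edge_def nxt_def n_def)
    then obtain i where "i < n" "v = c ! i" using n0 pre(3)[OF n0] by blast
    then show "2 \<le> degree ?G v" using deg2 by simp
  next
    fix e assume "e \<in> edges ?G"
    then obtain i where i: "i < n" "e = cyc_edge c i" using E by auto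
    moreover have "e \<in> D \<longleftrightarrow> i = 0" using inj_on_eq_iff[OF inj, of i 0] i n0 by (simp add: D_def)
    ultimately show "W True e + W False e = (if e \<in> D then 2 else 1)" using wp(1)[of i] W[of i] by simp
  next
    fix u v x assume uv: "{u, v} \<in> edges ?G" "0 < W x {u, v}"
    then obtain i where i: "i < n" "{u, v} = cyc_edge c i" using E by auto
    then have "u = c ! i \<and> v = c ! nxt i \<or> v = c ! i \<and> u = c ! nxt i"
      by (auto simp: cyc_edge_def nxt_def n_def doubleton_eq_iff)
    moreover have "0 < w x i" using uv(2) unfolding i(2) W[OF i(1)] .
    from wp(2)[OF i(1) this] have "wdeg ?G W h x (c ! i) \<noteq> wdeg ?G W h x (c ! nxt i)"
      unfolding deg[OF i(1)] deg[OF pre(3)[OF i(1)]] .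
    ultimately show "wdeg ?G W h x u \<noteq> wdeg ?G W h x v" by metis
  qed
  have half: "\<exists>x. (\<forall>y. h y v = half (L v) x y) \<and> (L v \<noteq> 0 \<longrightarrow> label_ok (L v) (wdeg ?G W h x v))"
    if v: "v \<in> set c" for v
  proof -
    obtain i where i: "i < n" "v = c ! i" using v unfolding in_set_conv_nth n_def by blast
    have "(\<forall>y. h y v = half (L v) (p i) y) \<and> (L v \<noteq> 0 \<longrightarrow> label_ok (L v) (wdeg ?G W h (p i) v))"
      using wp(3)[OF i(1)] unfolding i(2) deg[OF i(1)] h_def ix[OF i(1)] by blast
    then show ?thesis by blast
  qed
  have "card D \<le> 1" by (simp add: D_def)
  with valid half show ?thesis
    by (intro exI[of _ D] exI[of _ W] exI[of _ h] conjI ballI)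
qed

section \<open>Cycles in unions of graphs\<close>

definition simple :: "'v sgraph \<Rightarrow> bool" where
  "simple G \<longleftrightarrow> finite (verts G) \<and>
     (\<forall>e\<in>edges G. \<exists>a\<in>verts G. \<exists>b\<in>verts G. a \<noteq> b \<and> e = {a, b})"

lemma simple_edge_subset: "simple G \<Longrightarrow> e \<in> edges G \<Longrightarrow> e \<subseteq> verts G"
  unfolding simple_def by fastforce

lemma simple_finite_edges:
  assumes "simple G"
  shows "finite (edges G)"
proof -
  have "edges G \<subseteq> Pow (verts G)" using simple_edge_subset[OF assms] by auto
  then show ?thesis using assms finite_subset[of "edges G"] by (simp add: simple_def)
qed

lemma simple_union: "simple G \<Longrightarrow> simple H \<Longrightarrow> simple (graph_union G H)"
  unfolding simple_def graph_union_def by fastforce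

lemma path_edges_Nil [simp]: "path_edges [] = {}"
  and path_edges_single [simp]: "path_edges [x] = {}"
  by (auto simp: path_edges_def)

lemma path_edges_Cons [simp]: "path_edges (x # y # zs) = insert {x, y} (path_edges (y # zs))"
proof -
  have "{i. Suc i < length (x # y # zs)} = insert 0 (Suc ` {i. Suc i < length (y # zs)})"
  proof (rule set_eqI)
    show "i \<in> {i. Suc i < length (x # y # zs)} \<longleftrightarrow>
        i \<in> insert 0 (Suc ` {i. Suc i < length (y # zs)})" for i
      by (cases i) auto
  qed
  moreover have "path_edges p = (\<lambda>i. {p ! i, p ! Suc i}) ` {i. Suc i < length p}" for p :: "'a list"
    by (auto simp: path_edges_def)
  ultimately show ?thesis by (simp add: image_image)
qed

lemma path_edges_snoc: "xs \<noteq> [] \<Longrightarrow> path_edges (xs @ [x]) = insert {last xs, x} (path_edges xs)"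
  by (induction xs rule: induct_list012) auto

lemma path_edges_subset: "e \<in> path_edges p \<Longrightarrow> e \<subseteq> set p"
  by (induction p rule: induct_list012) auto

lemma simple_path: "distinct p \<Longrightarrow> simple (path_graph p)"
  unfolding simple_def path_graph_def path_edges_def
  by (auto simp: nth_eq_iff_index_eq intro!: bexI nth_mem)

lemma cycle_graph_rotate1:
  assumes "xs \<noteq> []"
  shows "cycle_graph (xs @ [x]) = cycle_graph (x # xs)"
proof -
  obtain y ys where "xs = y # ys" using assms by (cases xs) auto
  then show ?thesis
    using path_edges_snoc[OF assms, of x]
    by (auto simp: cycle_graph_def insert_commute)
qed

lemma cycle_graph_rotate: "cycle_graph (xs @ ys) = cycle_graph (ys @ xs)"
proof (induction ys arbitrary: xs)
  case (Cons y ys)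
  have "cycle_graph (xs @ y # ys) = cycle_graph (ys @ xs @ [y])"
    using Cons.IH[of "xs @ [y]"] by simp
  also have "\<dots> = cycle_graph ((y # ys) @ xs)"
    using cycle_graph_rotate1[of "ys @ xs" y] by (cases "ys @ xs = []") auto
  finally show ?case .
qed simp

lemma is_cycle_start:
  assumes "is_cycle C" "v \<in> verts C"
  obtains xs where "distinct (v # xs)" "3 \<le> length (v # xs)" "C = cycle_graph (v # xs)"
proof -
  obtain c where c: "distinct c" "3 \<le> length c" "C = cycle_graph c"
    using assms(1) is_cycle_def by blast
  then have "v \<in> set c" using assms(2) by (simp add: cycle_graph_def)
  then obtain ys zs where "c = ys @ v # zs" by (meson split_list)
  then show ?thesis
    using that[of "zs @ ys"] c cycle_graph_rotate[of ys "v # zs"] by auto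
qed

lemma is_cycle_nonempty:
  assumes "is_cycle C"
  obtains v where "v \<in> verts C"
proof -
  obtain c where "3 \<le> length c" "C = cycle_graph c" using assms is_cycle_def by blast
  then have "hd c \<in> verts C" by (cases c) (auto simp: cycle_graph_def)
  then show ?thesis using that by blast
qed

lemma simple_cycle:
  assumes "is_cycle C"
  shows "simple C"
proof -
  obtain c where c: "distinct c" "3 \<le> length c" "C = cycle_graph c"
    using assms is_cycle_def by blast
  then have "last c \<in> set c" "hd c \<in> set c" "last c \<noteq> hd c"
    by (cases c; auto)+
  then show ?thesis
    using simple_path[OF c(1)] c(3) unfolding simple_def cycle_graph_def path_graph_def by auto
qed

lemma cycle_degree:
  assumes "is_cycle C" "v \<in> verts C"
  shows "degree C v = 2"
proof -
  obtain xs where c: "distinct (v # xs)" "3 \<le> length (v # xs)" "C = cycle_graph (v # xs)"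
    using is_cycle_start[OF assms] .
  have "cyc_edge (v # xs) 0 \<noteq> cyc_edge (v # xs) (length xs)"
    using inj_onD[OF cyc_edge_inj[OF c(1,2)], of 0 "length xs"] c(2) by auto
  then show ?thesis
    using cycle_edges_at[OF c(1,2), of 0] unfolding degree_def c(3) by simp
qed

lemma cycle_verts_in_edges:
  assumes "is_cycle C" "v \<in> verts C"
  shows "\<exists>e\<in>edges C. v \<in> e"
  using cycle_degree[OF assms] unfolding degree_def
  by (metis (mono_tags, lifting) Collect_empty_eq card.empty zero_neq_numeral)

lemma cycle_card_edges: "is_cycle C \<Longrightarrow> 3 \<le> card (edges C)"
  unfolding is_cycle_def
  by (metis card_image card_lessThan cyc_edge_inj cycle_edges list.size(3) not_numeral_le_zero)

text \<open>An edge leaving a vertex of \<open>V1\<close> other than \<open>v\<close> cannot belong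
  to \<open>E2\<close>, so a path that avoids \<open>v\<close> never changes sides.\<close>

lemma path_one_side:
  assumes "path_edges xs \<subseteq> E1 \<union> E2" "v \<notin> set xs" "xs \<noteq> []" "hd xs \<in> V1"
    and "\<forall>e\<in>E1. e \<subseteq> V1" "\<forall>e\<in>E2. e \<subseteq> V2" "V1 \<inter> V2 \<subseteq> {v}"
  shows "set xs \<subseteq> V1 \<and> path_edges xs \<subseteq> E1"
  using assms(1-4)
proof (induction xs rule: induct_list012)
  case (3 x y zs)
  then have "x \<in> V1" "x \<noteq> v" "{x, y} \<in> E1 \<union> E2" by auto
  then have "{x, y} \<in> E1" using assms(6,7) by blast
  moreover from this have "y \<in> V1" using assms(5) by blast
  ultimately show ?case using 3 by auto
qed auto

text \<open>With the start put at \<open>v\<close> if the cycle contains it, the rest is a path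
  avoiding \<open>v\<close>. The side of the first edge therefore decides the whole path and the
  closing edge.\<close>

lemma cycle_one_side_aux:
  assumes c: "c = a # b # r" "distinct c" "3 \<le> length c" "v \<in> set c \<longrightarrow> a = v"
    and E: "edges (cycle_graph c) \<subseteq> E1 \<union> E2"
    and V: "\<forall>e\<in>E1. e \<subseteq> V1" "\<forall>e\<in>E2. e \<subseteq> V2" "V1 \<inter> V2 \<subseteq> {v}"
    and ab: "{a, b} \<in> E1"
  shows "edges (cycle_graph c) \<subseteq> E1"
proof -
  have "b \<in> V1" using ab V(1) by blast
  moreover have "v \<notin> set (b # r)" using c by auto
  moreover have "path_edges (b # r) \<subseteq> E1 \<union> E2" using E c(1) by (auto simp: cycle_graph_def)
  ultimately have r: "set (b # r) \<subseteq> V1" "path_edges (b # r) \<subseteq> E1"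
    using path_one_side[of "b # r" E1 E2 v V1 V2] V by auto
  have "last (b # r) \<in> set (b # r)" by simp
  then have "last (b # r) \<in> V1" "last (b # r) \<noteq> v" using r(1) \<open>v \<notin> set (b # r)\<close> by auto
  moreover have "{last (b # r), a} \<in> E1 \<union> E2" using E c(1) by (auto simp: cycle_graph_def)
  ultimately have "{last (b # r), a} \<in> E1" using V by blast
  then show ?thesis using r(2) ab c(1) by (simp add: cycle_graph_def)
qed

text \<open>A cycle cannot pass the cut vertex \<open>v\<close> twice.\<close>

lemma cycle_one_side:
  assumes "is_cycle C" and E: "edges C \<subseteq> E1 \<union> E2"
    and V: "\<forall>e\<in>E1. e \<subseteq> V1" "\<forall>e\<in>E2. e \<subseteq> V2" "V1 \<inter> V2 \<subseteq> {v}"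
  shows "edges C \<subseteq> E1 \<or> edges C \<subseteq> E2"
proof -
  obtain u where "u \<in> verts C" using is_cycle_nonempty[OF assms(1)] .
  \<comment> \<open>The cycle is read from the cut vertex whenever it passes through it.\<close>
  define a where "a = (if v \<in> verts C then v else u)"
  have a: "a \<in> verts C" "v \<in> verts C \<longrightarrow> a = v" using \<open>u \<in> verts C\<close> by (auto simp: a_def)
  obtain xs where xs: "distinct (a # xs)" "3 \<le> length (a # xs)" "C = cycle_graph (a # xs)"
    using is_cycle_start[OF assms(1) a(1)] .
  have "xs \<noteq> []" using xs(2) by auto
  then obtain b r where br: "xs = b # r" by (meson neq_Nil_conv)
  have c: "distinct (a # b # r)" "3 \<le> length (a # b # r)" "C = cycle_graph (a # b # r)"
    using xs unfolding br .
  have "verts C = set (a # b # r)" unfolding c(3) cycle_graph_def by simp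
  with a(2) have v: "v \<in> set (a # b # r) \<longrightarrow> a = v" by blast
  have "{a, b} \<in> E1 \<union> E2" using E unfolding c(3) by (auto simp: cycle_graph_def)
  then show ?thesis
  proof
    assume "{a, b} \<in> E1"
    from cycle_one_side_aux[OF refl c(1,2) v E[unfolded c(3)] V this] show ?thesis using c(3) by blast
  next
    assume "{a, b} \<in> E2"
    have E': "edges (cycle_graph (a # b # r)) \<subseteq> E2 \<union> E1" "V2 \<inter> V1 \<subseteq> {v}"
      using E V(3) unfolding c(3) by blast+
    from cycle_one_side_aux[OF refl c(1,2) v E'(1) V(2,1) E'(2) \<open>{a, b} \<in> E2\<close>]
    show ?thesis using c(3) by blast
  qed
qed

text \<open>The first edge and the rest of the path meet only in \<open>y\<close>, so a cycle would
  lie in one of them; a single edge is too small and the rest is excluded by induction.\<close>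

lemma no_cycle_in_path:
  assumes "is_cycle C" "distinct p"
  shows "\<not> edges C \<subseteq> path_edges p"
  using assms(2)
proof (induction p rule: induct_list012)
  case (3 x y zs)
  show ?case
  proof
    assume "edges C \<subseteq> path_edges (x # y # zs)"
    then have "edges C \<subseteq> {{x, y}} \<union> path_edges (y # zs)" by simp
    then have "edges C \<subseteq> {{x, y}} \<or> edges C \<subseteq> path_edges (y # zs)"
      by (rule cycle_one_side[OF assms(1), of _ _ "{x, y}" "set (y # zs)" y])
        (use 3 path_edges_subset[of _ "y # zs"] in \<open>auto simp del: path_edges_Cons\<close>)
    then have "edges C \<subseteq> {{x, y}}" using 3 by auto
    then have "card (edges C) \<le> 1" using card_mono[of "{{x, y}}" "edges C"] by simp
    then show False using cycle_card_edges[OF assms(1)] by simp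
  qed
qed (use cycle_card_edges[OF assms(1)] in auto)

section \<open>Hanging pieces from a graph\<close>

text \<open>\<open>L\<close> determines \<open>h\<close> up to the choice of one color at each
  labelled vertex; \<open>n\<close> bounds the number of doubled edges.\<close>

definition colorable :: "nat \<Rightarrow> ('v \<Rightarrow> nat) \<Rightarrow> 'v sgraph \<Rightarrow> bool" where
  "colorable n L G \<longleftrightarrow> (\<exists>D W h. valid G D W h \<and> card D \<le> n \<and>
     (\<forall>v\<in>verts G. \<exists>x. (\<forall>y. h y v = half (L v) x y) \<and>
        (L v \<noteq> 0 \<longrightarrow> label_ok (L v) (wdeg G W h x v))))"

lemma colorable_cong:
  assumes "colorable n L G" "\<And>v. v \<in> verts G \<Longrightarrow> L v = L' v" "n \<le> n'"
  shows "colorable n' L' G"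
proof -
  obtain D W h where "valid G D W h" "card D \<le> n"
    "\<forall>v\<in>verts G. \<exists>x. (\<forall>y. h y v = half (L v) x y) \<and> (L v \<noteq> 0 \<longrightarrow> label_ok (L v) (wdeg G W h x v))"
    using assms(1) unfolding colorable_def by (elim exE conjE)
  then show ?thesis
    using assms(2,3) unfolding colorable_def
    by (intro exI[of _ D] exI[of _ W] exI[of _ h] conjI) auto
qed

lemma colorable_cycle_graph:
  assumes "distinct c" "3 \<le> length c" "cycle_labelling_ok (map L c)"
  shows "colorable 1 L (cycle_graph c)"
  using cycle_valid[OF assms] unfolding colorable_def by (simp add: cycle_graph_def)

text \<open>A vertex labelled 1 or 2 serves as the start \<open>l0\<close> of
  \<open>labelled_closes\<close>; as the cycle has at least three vertices, a nonempty run remains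
  after its neighbor.\<close>

lemma cycle_colorable:
  assumes "is_cycle C" "u \<in> verts C" "L u \<in> {1, 2}" "\<forall>v\<in>verts C. L v \<le> 3"
  shows "colorable 1 L C"
proof -
  obtain xs where xs: "distinct (u # xs)" "3 \<le> length (u # xs)" "C = cycle_graph (u # xs)"
    using is_cycle_start[OF assms(1,2)] .
  then obtain y ys where y: "xs = y # ys" by (cases xs) auto
  then have "ys \<noteq> []" using xs(2) by auto
  have le: "\<forall>v\<in>set (u # xs). L v \<le> 3" using assms(4) xs(3) by (simp add: cycle_graph_def)
  have "\<exists>s b. run (map L ys) (True, s) b \<and> closes (L u) (L y) s b"
    using le y \<open>ys \<noteq> []\<close> assms(3) by (intro labelled_closes) auto
  then have "cycle_labelling_ok (map L (u # xs))"
    using cycle_labelling_okI y by auto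
  then show ?thesis using colorable_cycle_graph[OF xs(1,2)] xs(3) by simp
qed

text \<open>Another labelled vertex can serve as the start. Otherwise the root alone is labelled,
  which is the situation of \<open>unlabelled_closes\<close>.\<close>

lemma cycle_colorable_root:
  assumes "is_cycle C" "x \<in> verts C" "\<forall>v\<in>verts C. L v \<le> 2"
  shows "colorable 1 (L(x := 3)) C"
proof (cases "\<exists>u\<in>verts C. u \<noteq> x \<and> L u \<noteq> 0")
  case True
  then obtain u where u: "u \<in> verts C" "u \<noteq> x" "L u \<noteq> 0" by blast
  have "L u \<le> 2" using assms(3) u(1) by blast
  then have "(L(x := 3)) u \<in> {1, 2}" using u(2,3) by auto
  moreover have "\<forall>v\<in>verts C. (L(x := 3)) v \<le> 3" using assms(3) by fastforce
  ultimately show ?thesis by (rule cycle_colorable[OF assms(1) u(1)])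
next
  case False
  obtain xs where xs: "distinct (x # xs)" "3 \<le> length (x # xs)" "C = cycle_graph (x # xs)"
    using is_cycle_start[OF assms(1,2)] .
  then obtain zs b where zs: "xs = zs @ [b]" by (cases xs rule: rev_cases) auto
  then obtain ys a where ys: "zs = ys @ [a]" using xs(2) by (cases zs rule: rev_cases) auto
  have xs_eq: "xs = ys @ [a, b]" using zs ys by simp
  \<comment> \<open>The rotation puts the doubled edge \<open>{a, b}\<close> first and the root
    \<open>x\<close> right after it.\<close>
  define c where "c = a # b # x # ys"
  have c: "C = cycle_graph c" "distinct c" "3 \<le> length c"
    using xs cycle_graph_rotate[of "x # ys" "[a, b]"] by (auto simp: c_def xs_eq)
  have 0: "(L(x := 3)) v = 0" if "v \<in> set (a # b # ys)" for v
    using False c that by (auto simp: c_def cycle_graph_def)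
  then have "map (L(x := 3)) ys = map (\<lambda>_. 0) ys" by simp
  then have "map (L(x := 3)) c = 0 # 0 # 3 # replicate (length ys) 0"
    using 0 by (simp add: c_def map_replicate_const)
  moreover obtain s b where "run (3 # replicate (length ys) 0) (True, s) b" "closes 0 0 s b"
    using unlabelled_closes by blast
  then have "cycle_labelling_ok (0 # 0 # 3 # replicate (length ys) 0)"
    by (rule cycle_labelling_okI)
  ultimately show ?thesis using colorable_cycle_graph[OF c(2,3)] c(1) by simp
qed

section \<open>Joining two graphs by an edge\<close>

definition join :: "'v sgraph \<Rightarrow> 'v \<Rightarrow> 'v \<Rightarrow> 'v sgraph \<Rightarrow> 'v sgraph" where
  "join G y x H = \<lparr>verts = verts G \<union> verts H, edges = insert {y, x} (edges G \<union> edges H)\<rparr>"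

lemma join_commute: "join G y x H = join H x y G"
  by (simp add: join_def insert_commute Un_commute)

lemma edges_at_join:
  assumes "simple G" "simple H" "verts G \<inter> verts H = {}" "x \<in> verts H" "v \<in> verts G"
  shows "{e \<in> edges (join G y x H). v \<in> e} =
    (if v = y then insert {y, x} {e \<in> edges G. v \<in> e} else {e \<in> edges G. v \<in> e})"
proof -
  have "v \<notin> e" if "e \<in> edges H" for e
    using simple_edge_subset[OF assms(2) that] assms(3,5) by blast
  moreover have "v \<noteq> x" using assms by blast
  ultimately show ?thesis unfolding join_def by auto
qed

lemma join_edge_new:
  assumes "simple G" "verts G \<inter> verts H = {}" "x \<in> verts H"
  shows "{y, x} \<notin> edges G"
  using simple_edge_subset[OF assms(1)] assms(2,3) by blast

lemma degree_join:
  assumes "simple G" "simple H" "verts G \<inter> verts H = {}" "x \<in> verts H" "v \<in> verts G"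
  shows "degree (join G y x H) v = degree G v + of_bool (v = y)"
proof -
  have "finite {e \<in> edges G. v \<in> e}" using simple_finite_edges[OF assms(1)] by simp
  then show ?thesis
    using join_edge_new[OF assms(1,3,4), of y] unfolding degree_def edges_at_join[OF assms]
    by (cases "v = y") auto
qed

lemma wdeg_join:
  assumes "simple G" "simple H" "verts G \<inter> verts H = {}" "x \<in> verts H" "v \<in> verts G"
    and "\<And>e. e \<in> edges G \<Longrightarrow> W c e = W1 c e" "v = y \<Longrightarrow> h1 c v = W c {y, x} + h c v"
    "v \<noteq> y \<Longrightarrow> h c v = h1 c v"
  shows "wdeg (join G y x H) W h c v = wdeg G W1 h1 c v"
proof -
  have fin: "finite {e \<in> edges G. v \<in> e}" using simple_finite_edges[OF assms(1)] by simp
  have "sum (W c) {e \<in> edges G. v \<in> e} = sum (W1 c) {e \<in> edges G. v \<in> e}"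
    using assms(6) by (intro sum.cong) auto
  then show ?thesis
    using join_edge_new[OF assms(1,3,4), of y] fin assms(7,8) unfolding wdeg_def edges_at_join[OF assms(1-5)]
    by auto
qed

text \<open>Takes away the half-edge that turns into the connecting edge. \<open>join_valid\<close>
  assumes one to be present, so the subtraction is not truncated.\<close>

definition unhalf :: "bool \<Rightarrow> 'v \<Rightarrow> (bool \<Rightarrow> 'v \<Rightarrow> nat) \<Rightarrow> bool \<Rightarrow> 'v \<Rightarrow> nat" where
  "unhalf c y h c' v = h c' v - of_bool (c' = c \<and> v = y)"

text \<open>Two half-edges of color \<open>c\<close> are replaced by one edge of color
  \<open>c\<close>. All degrees stay as they were, so the only new requirement concerns the ends of
  that edge.\<close>

lemma join_valid:
  assumes s: "simple G" "simple H" "verts G \<inter> verts H = {}" "y \<in> verts G" "x \<in> verts H"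
    and v: "valid G D1 W1 h1" "valid H D2 W2 h2"
    and c: "0 < h1 c y" "0 < h2 c x" "wdeg G W1 h1 c y \<noteq> wdeg H W2 h2 c x"
    and h: "\<And>c' v. v \<in> verts G \<Longrightarrow> h c' v = unhalf c y h1 c' v"
      "\<And>c' v. v \<in> verts H \<Longrightarrow> h c' v = unhalf c x h2 c' v"
  shows "\<exists>W. valid (join G y x H) (D1 \<union> D2) W h \<and>
    (\<forall>c' v. v \<in> verts G \<longrightarrow> wdeg (join G y x H) W h c' v = wdeg G W1 h1 c' v) \<and>
    (\<forall>c' v. v \<in> verts H \<longrightarrow> wdeg (join G y x H) W h c' v = wdeg H W2 h2 c' v)"
proof -
  let ?J = "join G y x H"
  have s': "verts H \<inter> verts G = {}" using s(3) by blast
  have sub: "e \<subseteq> verts G" if "e \<in> edges G" for e using simple_edge_subset[OF s(1) that] .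
  have sub': "e \<subseteq> verts H" if "e \<in> edges H" for e using simple_edge_subset[OF s(2) that] .
  have ne: "e \<noteq> {}" if "e \<in> edges H" for e using that s(2) unfolding simple_def by blast
  have disj: "e \<notin> edges G" if "e \<in> edges H" for e using sub sub' ne that s(3) by blast
  have new: "{y, x} \<notin> edges G" "{y, x} \<notin> edges H"
    using join_edge_new[OF s(1,3,5), of y] join_edge_new[OF s(2) s' s(4), of x]
    by (simp_all add: insert_commute)
  define W where "W c' e = (if e = {y, x} then of_bool (c' = c) else if e \<in> edges G then W1 c' e else W2 c' e)" for c' e
  have WG: "W c' e = W1 c' e" if "e \<in> edges G" for c' e using that new by (auto simp: W_def)
  have WH: "W c' e = W2 c' e" if "e \<in> edges H" for c' e using that new disj by (auto simp: W_def)
  have WN: "W c' {y, x} = of_bool (c' = c)" for c' by (simp add: W_def)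
  have dG: "wdeg ?J W h c' v = wdeg G W1 h1 c' v" if "v \<in> verts G" for c' v
    by (rule wdeg_join[OF s(1-3,5) that])
      (use WG WN h(1)[OF that] c(1) in \<open>auto simp: unhalf_def\<close>)
  have dH: "wdeg ?J W h c' v = wdeg H W2 h2 c' v" if "v \<in> verts H" for c' v
    unfolding join_commute[of G]
    by (rule wdeg_join[OF s(2,1) s' s(4) that])
      (use WH WN h(2)[OF that] c(2) in \<open>auto simp: unhalf_def insert_commute\<close>)
  have D: "D1 \<subseteq> edges G" "D2 \<subseteq> edges H" using v by (auto simp: valid_def matching_def)
  have degG: "degree G v \<le> degree ?J v" if "v \<in> verts G" for v
    using degree_join[OF s(1-3,5) that] by simp
  have degH: "degree H v \<le> degree ?J v" if "v \<in> verts H" for v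
    using degree_join[OF s(2,1) s' s(4) that] unfolding join_commute[of G] by simp
  have "valid ?J (D1 \<union> D2) W h"
    unfolding valid_def
  proof (intro conjI ballI allI impI)
    have "disjnt d e" if "d \<in> D1" "e \<in> D2" for d e
      using that D sub sub' s(3) unfolding disjnt_def by blast
    then have "pairwise disjnt (D1 \<union> D2)"
      using v unfolding valid_def matching_def pairwise_def by (metis Un_iff disjnt_sym)
    then show "matching ?J (D1 \<union> D2)" using D by (auto simp: matching_def join_def)
  next
    fix e u assume e: "e \<in> D1 \<union> D2" "u \<in> e"
    from e(1) show "2 \<le> degree ?J u"
    proof
      assume "e \<in> D1"
      then have "u \<in> verts G" "2 \<le> degree G u" using e(2) D(1) sub v(1) unfolding valid_def by blast+
      then show ?thesis using degG[of u] by simp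
    next
      assume "e \<in> D2"
      then have "u \<in> verts H" "2 \<le> degree H u" using e(2) D(2) sub' v(2) unfolding valid_def by blast+
      then show ?thesis using degH[of u] by simp
    qed
  next
    fix e assume "e \<in> edges ?J"
    then consider "e = {y, x}" | "e \<in> edges G" | "e \<in> edges H" by (auto simp: join_def)
    then show "W True e + W False e = (if e \<in> D1 \<union> D2 then 2 else 1)"
    proof cases
      case 1
      then have "e \<notin> D1 \<union> D2" using new D by blast
      then show ?thesis using 1 WN by simp
    next
      case 2
      then have "e \<notin> D2" using D disj by blast
      then show ?thesis using 2 WG v(1) unfolding valid_def by simp
    next
      case 3
      then have "e \<notin> D1" using D disj by blast
      then show ?thesis using 3 WH v(2) unfolding valid_def by simp
    qed
  next
    fix a b c' assume ab: "{a, b} \<in> edges ?J" "0 < W c' {a, b}"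
    then consider "{a, b} = {y, x}" | "{a, b} \<in> edges G" | "{a, b} \<in> edges H" by (auto simp: join_def)
    then show "wdeg ?J W h c' a \<noteq> wdeg ?J W h c' b"
    proof cases
      case 1
      then have "c' = c" using ab(2) WN[of c'] by (cases "c' = c") auto
      moreover have "a = y \<and> b = x \<or> a = x \<and> b = y" using 1 by (simp add: doubleton_eq_iff)
      ultimately show ?thesis using dG[OF s(4), of c] dH[OF s(5), of c] c(3) by auto
    next
      case 2
      moreover from this have "a \<in> verts G" "b \<in> verts G" using sub by auto
      ultimately show ?thesis using v(1) ab(2) WG dG unfolding valid_def by simp
    next
      case 3
      moreover from this have "a \<in> verts H" "b \<in> verts H" using sub' by auto
      ultimately show ?thesis using v(2) ab(2) WH dH unfolding valid_def by simp
    qed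
  qed
  then show ?thesis using dG dH by blast
qed

section \<open>Exchanging the two colors\<close>

lemma wdeg_swap: "wdeg G (\<lambda>c. W (\<not> c)) (\<lambda>c. h (\<not> c)) c v = wdeg G W h (\<not> c) v"
  by (simp add: wdeg_def)

lemma valid_swap: "valid G D W h \<Longrightarrow> valid G D (\<lambda>c. W (\<not> c)) (\<lambda>c. h (\<not> c))"
  unfolding valid_def wdeg_swap by (auto simp: add.commute)

text \<open>After exchanging the colors if necessary, the half-edge at \<open>y\<close> has any
  prescribed color \<open>c\<close>, so that two half-edges can be matched.\<close>

lemma colorable_at:
  assumes "colorable n L G" "y \<in> verts G" "L y \<noteq> 0"
  obtains D W h where "valid G D W h" "card D \<le> n"
    "\<forall>v\<in>verts G. \<exists>x. (\<forall>y. h y v = half (L v) x y) \<and> (L v \<noteq> 0 \<longrightarrow> label_ok (L v) (wdeg G W h x v))"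
    "\<forall>z. h z y = half (L y) c z" "label_ok (L y) (wdeg G W h c y)"
proof -
  obtain D W h where *: "valid G D W h" "card D \<le> n"
    "\<forall>v\<in>verts G. \<exists>x. (\<forall>y. h y v = half (L v) x y) \<and> (L v \<noteq> 0 \<longrightarrow> label_ok (L v) (wdeg G W h x v))"
    using assms(1) unfolding colorable_def by (elim exE conjE)
  then obtain x where x: "\<forall>z. h z y = half (L y) x z" "label_ok (L y) (wdeg G W h x y)"
    using assms(2,3) by blast
  show thesis
  proof (cases "x = c")
    case True
    then show thesis using that[OF *] x by blast
  next
    case False
    then have c: "c = (\<not> x)" by auto
    have h: "half l (\<not> p) z = half l p (\<not> z)" for l p z by (auto simp: half_def)
    show thesis
    proof (rule that[OF valid_swap[OF *(1)] *(2)])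
      show "\<forall>v\<in>verts G. \<exists>x. (\<forall>y. h (\<not> y) v = half (L v) x y) \<and>
          (L v \<noteq> 0 \<longrightarrow> label_ok (L v) (wdeg G (\<lambda>c. W (\<not> c)) (\<lambda>c. h (\<not> c)) x v))"
      proof
        fix v assume "v \<in> verts G"
        with *(3) obtain x where "\<forall>y. h y v = half (L v) x y" "L v \<noteq> 0 \<longrightarrow> label_ok (L v) (wdeg G W h x v)"
          by blast
        then show "\<exists>x. (\<forall>y. h (\<not> y) v = half (L v) x y) \<and>
          (L v \<noteq> 0 \<longrightarrow> label_ok (L v) (wdeg G (\<lambda>c. W (\<not> c)) (\<lambda>c. h (\<not> c)) x v))"
          by (intro exI[of _ "\<not> x"]) (simp add: wdeg_swap h)
      qed
    qed (use x in \<open>simp_all add: wdeg_swap h c\<close>)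
  qed
qed

lemma wdeg_ge: "h c v \<le> wdeg G W h c v"
  by (simp add: wdeg_def)

text \<open>The piece \<open>H\<close> is colored first. The degree of its root then becomes the
  label of \<open>y\<close>, and this label forces different degrees at the two ends of the
  connecting edge.\<close>

lemma colorable_join:
  assumes s: "simple G" "simple H" "verts G \<inter> verts H = {}" "y \<in> verts G" "x \<in> verts H"
    and H: "colorable n (L(x := 3)) H" and G: "\<And>d. d \<in> {1, 2} \<Longrightarrow> colorable m (L(y := d)) G"
    and L: "L x = 0" "L y = 0"
  shows "colorable (m + n) L (join G y x H)"
proof -
  have x3: "(L(x := 3)) x \<noteq> 0" by simp
  obtain D2 W2 h2 where 2: "valid H D2 W2 h2" "card D2 \<le> n"
    "\<forall>v\<in>verts H. \<exists>z. (\<forall>y. h2 y v = half ((L(x := 3)) v) z y) \<and>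
       ((L(x := 3)) v \<noteq> 0 \<longrightarrow> label_ok ((L(x := 3)) v) (wdeg H W2 h2 z v))"
    "\<forall>z. h2 z x = half ((L(x := 3)) x) True z" "label_ok ((L(x := 3)) x) (wdeg H W2 h2 True x)"
    by (rule colorable_at[OF H s(5) x3])
  define d where "d = wdeg H W2 h2 True x"
  have h2x: "h2 z x = of_bool z" for z using 2(4) by (simp add: half_def)
  \<comment> \<open>Label 3 bounds \<open>d\<close> from above, and the half-edge itself makes it
    positive.\<close>
  have "d \<le> 2" using 2(5) by (simp add: d_def label_ok_def)
  moreover have "1 \<le> d" using wdeg_ge[of h2 True x H W2] h2x by (simp add: d_def)
  ultimately have d: "d \<in> {1, 2}" by auto
  then have yd: "(L(y := d)) y \<noteq> 0" by auto
  obtain D1 W1 h1 where 1: "valid G D1 W1 h1" "card D1 \<le> m"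
    "\<forall>v\<in>verts G. \<exists>z. (\<forall>x. h1 x v = half ((L(y := d)) v) z x) \<and>
       ((L(y := d)) v \<noteq> 0 \<longrightarrow> label_ok ((L(y := d)) v) (wdeg G W1 h1 z v))"
    "\<forall>z. h1 z y = half ((L(y := d)) y) True z" "label_ok ((L(y := d)) y) (wdeg G W1 h1 True y)"
    by (rule colorable_at[OF G[OF d] s(4) yd])
  have h1y: "h1 z y = of_bool z" for z using 1(4) d by (auto simp: half_def)
  have ne: "wdeg G W1 h1 True y \<noteq> wdeg H W2 h2 True x"
    using 1(5) d unfolding d_def[symmetric] by (auto simp: label_ok_def)
  define h where "h c v = (if v \<in> verts G then unhalf True y h1 c v else unhalf True x h2 c v)" for c v
  have h: "h c v = unhalf True y h1 c v" if "v \<in> verts G" for c v using that by (simp add: h_def)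
  have h': "h c v = unhalf True x h2 c v" if "v \<in> verts H" for c v using that s(3) by (auto simp: h_def)
  obtain W where W: "valid (join G y x H) (D1 \<union> D2) W h"
    "\<forall>c v. v \<in> verts G \<longrightarrow> wdeg (join G y x H) W h c v = wdeg G W1 h1 c v"
    "\<forall>c v. v \<in> verts H \<longrightarrow> wdeg (join G y x H) W h c v = wdeg H W2 h2 c v"
    using join_valid[OF s 1(1) 2(1) _ _ ne, of h] h h' h1y h2x by auto
  have "\<exists>z. (\<forall>y. h y v = half (L v) z y) \<and> (L v \<noteq> 0 \<longrightarrow> label_ok (L v) (wdeg (join G y x H) W h z v))"
    if "v \<in> verts (join G y x H)" for v
  proof -
    consider "v = x" | "v = y" | "v \<in> verts G" "v \<noteq> y" | "v \<in> verts H" "v \<noteq> x"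
      using \<open>v \<in> verts (join G y x H)\<close> by (auto simp: join_def)
    then show ?thesis
    proof cases
      case 1
      then have "h z v = 0" for z using h'[OF s(5)] h2x by (simp add: unhalf_def)
      then show ?thesis using 1 L by (simp add: half_def)
    next
      case 2
      then have "h z v = 0" for z using h[OF s(4)] h1y by (simp add: unhalf_def)
      then show ?thesis using 2 L by (simp add: half_def)
    next
      case 3
      then have "h z v = h1 z v" for z using h by (simp add: unhalf_def)
      then show ?thesis using bspec[OF 1(3) 3(1)] 3 W(2) by simp
    next
      case 4
      then have "h z v = h2 z v" for z using h' by (simp add: unhalf_def)
      then show ?thesis using bspec[OF 2(3) 4(1)] 4 W(3) by simp
    qed
  qed
  moreover have "card (D1 \<union> D2) \<le> m + n" using 1(2) 2(2) card_Un_le[of D1 D2] by linarith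
  ultimately show ?thesis
    using W(1) unfolding colorable_def
    by (intro exI[of _ "D1 \<union> D2"] exI[of _ W] exI[of _ h] conjI ballI) auto
qed

text \<open>The new root starts as an isolated vertex with two half-edges: one of color
  \<open>True\<close> becomes the edge to \<open>x\<close>, the other stays as its root
  half-edge.\<close>

lemma colorable_join_vertex:
  assumes s: "simple H" "y \<notin> verts H" "x \<in> verts H"
    and H: "colorable n (L(x := 3)) H" and L: "L x = 0"
  shows "colorable n (L(y := 3)) (join \<lparr>verts = {y}, edges = {}\<rparr> y x H)"
proof -
  let ?Y = "\<lparr>verts = {y}, edges = {}\<rparr>"
  have x3: "(L(x := 3)) x \<noteq> 0" by simp
  obtain D2 W2 h2 where 2: "valid H D2 W2 h2" "card D2 \<le> n"
    "\<forall>v\<in>verts H. \<exists>z. (\<forall>y. h2 y v = half ((L(x := 3)) v) z y) \<and>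
       ((L(x := 3)) v \<noteq> 0 \<longrightarrow> label_ok ((L(x := 3)) v) (wdeg H W2 h2 z v))"
    "\<forall>z. h2 z x = half ((L(x := 3)) x) True z" "label_ok ((L(x := 3)) x) (wdeg H W2 h2 True x)"
    by (rule colorable_at[OF H s(3) x3])
  define d where "d = wdeg H W2 h2 True x"
  have h2x: "h2 z x = of_bool z" for z using 2(4) by (simp add: half_def)
  have "d \<le> 2" using 2(5) by (simp add: d_def label_ok_def)
  moreover have "1 \<le> d" using wdeg_ge[of h2 True x H W2] h2x by (simp add: d_def)
  ultimately have d: "d \<in> {1, 2}" by auto
  \<comment> \<open>Equal colors give \<open>y\<close> degree 2 in color \<open>True\<close>, and
    different ones give degree 1, so this choice avoids \<open>d\<close>.\<close>
  define c where "c \<longleftrightarrow> d = 1"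
  define h1 :: "bool \<Rightarrow> 'a \<Rightarrow> nat" where "h1 z v = of_bool (z = True) + of_bool (z = c)" for z v
  have Y: "simple ?Y" "valid ?Y {} W2 h1"
    by (auto simp: simple_def valid_def matching_def)
  have wY: "wdeg ?Y W2 h1 z y = h1 z y" for z by (simp add: wdeg_def)
  have ne: "wdeg ?Y W2 h1 True y \<noteq> wdeg H W2 h2 True x"
    using d unfolding d_def[symmetric] wY by (auto simp: h1_def c_def)
  define h where "h z v = (if v = y then of_bool (z = c) else unhalf True x h2 z v)" for z v
  have h: "h z v = unhalf True y h1 z v" if "v \<in> verts ?Y" for z v
    using that by (auto simp: h_def unhalf_def h1_def)
  have h': "h z v = unhalf True x h2 z v" if "v \<in> verts H" for z v using that s(2) by (auto simp: h_def)
  have disj: "verts ?Y \<inter> verts H = {}" "y \<in> verts ?Y" using s(2) by auto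
  have pos: "0 < h1 True y" "0 < h2 True x" using h2x by (auto simp: h1_def)
  obtain W where W: "valid (join ?Y y x H) ({} \<union> D2) W h"
    "\<forall>c v. v \<in> verts ?Y \<longrightarrow> wdeg (join ?Y y x H) W h c v = wdeg ?Y W2 h1 c v"
    "\<forall>c v. v \<in> verts H \<longrightarrow> wdeg (join ?Y y x H) W h c v = wdeg H W2 h2 c v"
    using join_valid[OF Y(1) s(1) disj s(3) Y(2) 2(1) pos ne h h'] by blast
  have "\<exists>z. (\<forall>u. h u v = half ((L(y := 3)) v) z u) \<and>
      ((L(y := 3)) v \<noteq> 0 \<longrightarrow> label_ok ((L(y := 3)) v) (wdeg (join ?Y y x H) W h z v))"
    if "v \<in> verts (join ?Y y x H)" for v
  proof -
    consider "v = x" | "v = y" | "v \<in> verts H" "v \<noteq> x"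
      using \<open>v \<in> verts (join ?Y y x H)\<close> by (auto simp: join_def)
    then show ?thesis
    proof cases
      case 1
      then have "h z v = 0" for z using h'[OF s(3)] h2x by (simp add: unhalf_def)
      moreover have "v \<noteq> y" using 1 s by blast
      ultimately show ?thesis using 1 L by (simp add: half_def)
    next
      case 2
      then have "h z v = half 3 c z" for z by (auto simp: h_def half_def)
      moreover have "wdeg (join ?Y y x H) W h c v = h1 c y" using W(2) wY 2 by simp
      then have "label_ok 3 (wdeg (join ?Y y x H) W h c v)" by (simp add: label_ok_def h1_def)
      ultimately show ?thesis using 2 by auto
    next
      case 3
      then have "h z v = h2 z v" for z using h' by (simp add: unhalf_def)
      moreover have "v \<noteq> y" using 3 s by blast
      ultimately show ?thesis using bspec[OF 2(3) 3(1)] 3 W(3) by simp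
    qed
  qed
  then show ?thesis
    using W(1) 2(2) unfolding colorable_def
    by (intro exI[of _ D2] exI[of _ W] exI[of _ h] conjI ballI) auto
qed


text \<open>The root moves from \<open>last p\<close> back to \<open>hd p\<close>, one vertex at a
  time; \<open>K\<close> is what hangs at the far end.\<close>

lemma hang_path:
  assumes "p \<noteq> []" "distinct p" "verts K \<inter> set p \<subseteq> {last p}" "simple K" "\<forall>v\<in>set p. L v = 0"
    and "colorable n (L(last p := 3)) (graph_union (path_graph [last p]) K)"
  shows "colorable n (L(hd p := 3)) (graph_union (path_graph p) K)"
  using assms
proof (induction p rule: induct_list012)
  case (3 x y zs)
  let ?H = "graph_union (path_graph (y # zs)) K"
  have "colorable n (L(hd (y # zs) := 3)) ?H" using "3.prems" by (intro "3.IH"(2)) auto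
  then have "colorable n (L(y := 3)) ?H" by simp
  moreover have "simple ?H" using 3 by (intro simple_union simple_path) auto
  moreover have "x \<noteq> last (y # zs)" using 3(4) by (metis distinct.simps(2) last_in_set list.discI)
  then have "x \<notin> verts ?H" using 3 by (auto simp: graph_union_def path_graph_def)
  moreover have "y \<in> verts ?H" by (simp add: graph_union_def path_graph_def)
  moreover have "L y = 0" using 3 by simp
  ultimately have "colorable n (L(x := 3)) (join \<lparr>verts = {x}, edges = {}\<rparr> x y ?H)"
    by (intro colorable_join_vertex) auto
  moreover have "join \<lparr>verts = {x}, edges = {}\<rparr> x y ?H = graph_union (path_graph (x # y # zs)) K"
    by (simp add: join_def graph_union_def path_graph_def insert_commute)
  ultimately show ?case by (simp only: list.sel)
qed auto

text \<open>The smallest piece: the half-edge alone gives its root degree 1.\<close>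

lemma colorable_vertex: "colorable 0 (L(x := 3)) \<lparr>verts = {x}, edges = {}\<rparr>"
proof -
  let ?G = "\<lparr>verts = {x}, edges = {}\<rparr>" and ?h = "\<lambda>c _. half 3 True c"
  have "valid ?G {} (\<lambda>_ _. 0) ?h" by (simp add: valid_def matching_def)
  moreover have "\<exists>z. (\<forall>y. ?h y v = half ((L(x := 3)) v) z y) \<and>
      ((L(x := 3)) v \<noteq> 0 \<longrightarrow> label_ok ((L(x := 3)) v) (wdeg ?G (\<lambda>_ _. 0) ?h z v))" if "v \<in> verts ?G" for v
    using that by (intro exI[of _ True]) (simp add: wdeg_def half_def label_ok_def)
  ultimately show ?thesis
    unfolding colorable_def
    by (intro exI[of _ "{}"] exI[of _ "\<lambda>_ _. 0"] exI[of _ ?h] conjI ballI) simp_all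
qed

text \<open>Invariant of the induction along the construction: labels stand only where a piece may
  still be hung. For a cycle some label must be present, to provide a start for
  \<open>cycle_colorable\<close>.\<close>

definition extendable :: "'v sgraph \<Rightarrow> bool" where
  "extendable G \<longleftrightarrow> (\<forall>L. (\<forall>u. L u \<le> 2) \<and>
     (\<forall>u. L u \<noteq> 0 \<longrightarrow> degree G u = 2 \<and> (\<exists>C\<in>cycles G. u \<in> verts C)) \<and>
     (is_cycle G \<longrightarrow> (\<exists>u. L u \<noteq> 0)) \<longrightarrow> colorable (card (cycles G)) L G)"

lemma finite_cycles:
  assumes "simple G"
  shows "finite (cycles G)"
proof (rule finite_subset)
  show "cycles G \<subseteq> (\<lambda>(V, E). \<lparr>verts = V, edges = E\<rparr>) ` (Pow (verts G) \<times> Pow (edges G))"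
  proof
    fix C assume "C \<in> cycles G"
    then have "verts C \<subseteq> verts G" "edges C \<subseteq> edges G" by (auto simp: cycles_def subgraph_def)
    then show "C \<in> (\<lambda>(V, E). \<lparr>verts = V, edges = E\<rparr>) ` (Pow (verts G) \<times> Pow (edges G))"
      by (intro image_eqI[of _ _ "(verts C, edges C)"]) auto
  qed
  show "finite ((\<lambda>(V, E). \<lparr>verts = V, edges = E\<rparr>) ` (Pow (verts G) \<times> Pow (edges G)))"
    using assms simple_finite_edges[OF assms] by (auto simp: simple_def)
qed

lemma cycle_verts_subset:
  assumes "is_cycle C" "edges C \<subseteq> edges G" "simple G"
  shows "verts C \<subseteq> verts G"
proof
  fix u assume "u \<in> verts C"
  then obtain e where "e \<in> edges C" "u \<in> e" using cycle_verts_in_edges[OF assms(1)] by blast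
  then show "u \<in> verts G" using assms(2) simple_edge_subset[OF assms(3)] by blast
qed

lemma extendable_cycle:
  fixes C :: "'v sgraph"
  assumes "is_cycle C"
  shows "extendable C"
  unfolding extendable_def
proof (intro allI impI, elim conjE)
  fix L :: "'v \<Rightarrow> nat"
  assume L: "\<forall>u. L u \<le> 2" "\<forall>u. L u \<noteq> 0 \<longrightarrow> degree C u = 2 \<and> (\<exists>C'\<in>cycles C. u \<in> verts C')"
    "is_cycle C \<longrightarrow> (\<exists>u. L u \<noteq> 0)"
  then obtain u where u: "L u \<noteq> 0" using assms by blast
  then have "u \<in> verts C" using L(2) by (auto simp: cycles_def subgraph_def)
  moreover have "L u \<le> 2" using L(1) by blast
  then have "L u \<in> {1, 2}" using u by auto
  moreover have "L v \<le> 3" for v using spec[OF L(1), of v] by simp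
  then have "\<forall>v\<in>verts C. L v \<le> 3" by blast
  ultimately have "colorable 1 L C" by (rule cycle_colorable[OF assms])
  moreover have "{C} \<subseteq> cycles C" using assms by (simp add: cycles_def subgraph_def)
  then have "1 \<le> card (cycles C)"
    using card_mono[OF finite_cycles[OF simple_cycle[OF assms]], of "{C}"] by simp
  ultimately show "colorable (card (cycles C)) L C" using colorable_cong by blast
qed

text \<open>Treats both construction rules at once: \<open>K\<close> is empty or the new cycle, and
  \<open>n\<close> is the number of doubled edges allowed in the new piece.\<close>

lemma extendable_hang:
  fixes G :: "'v sgraph"
  assumes G: "simple G" "extendable G"
    and v: "v \<in> verts G" "degree G v = 2" "\<exists>C\<in>cycles G. v \<in> verts C"
    and p: "distinct p" "2 \<le> length p" "hd p = v" "set p \<inter> verts G = {v}"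
    and K: "simple K" "verts K \<inter> verts G = {}" "verts K \<inter> set p \<subseteq> {last p}"
    and degK: "last p \<in> verts K \<Longrightarrow> 2 \<le> degree K (last p)"
    and n: "\<And>L. \<forall>u. L u \<le> 2 \<Longrightarrow> colorable n (L(last p := 3)) (graph_union (path_graph [last p]) K)"
      "card (cycles G) + n \<le> card (cycles (graph_union (graph_union G (path_graph p)) K))"
  shows "extendable (graph_union (graph_union G (path_graph p)) K)"
proof -
  let ?J = "graph_union (graph_union G (path_graph p)) K"
  obtain y q where pq: "p = v # y # q"
    using p(2,3) by (cases p; cases "tl p") auto
  let ?H = "graph_union (path_graph (y # q)) K"
  have J: "?J = join G v y ?H"
    using v(1) by (auto simp: pq graph_union_def path_graph_def join_def)
  have H: "simple ?H" using p(1) K(1) unfolding pq by (intro simple_union simple_path) auto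
  have disj: "verts G \<inter> verts ?H = {}" using p K(2) by (auto simp: pq graph_union_def path_graph_def)
  have y: "y \<in> verts ?H" by (simp add: graph_union_def path_graph_def)
  have simp_J: "simple ?J" using simple_union simple_path G(1) p(1) K(1) by blast
  \<comment> \<open>Cutting at \<open>v\<close> and then at \<open>last p\<close> leaves a cycle on
    one side each time, and the path contains none.\<close>
  have cyc: "C \<in> cycles G \<or> verts C \<subseteq> verts K" if "C \<in> cycles ?J" for C
  proof -
    have C: "is_cycle C" using that by (simp add: cycles_def)
    have E: "edges C \<subseteq> edges G \<union> (path_edges p \<union> edges K)"
      using that by (auto simp: cycles_def subgraph_def graph_union_def path_graph_def)
    have sG: "\<forall>e\<in>edges G. e \<subseteq> verts G" and sK: "\<forall>e\<in>edges K. e \<subseteq> verts K"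
      using simple_edge_subset[OF G(1)] simple_edge_subset[OF K(1)] by auto
    have sp: "\<forall>e\<in>path_edges p. e \<subseteq> set p" using path_edges_subset by fast
    have spK: "\<forall>e\<in>path_edges p \<union> edges K. e \<subseteq> set p \<union> verts K" using sK sp by blast
    have "verts G \<inter> (set p \<union> verts K) \<subseteq> {v}" using p(4) K(2) by blast
    from cycle_one_side[OF C E sG spK this] show ?thesis
    proof
      assume "edges C \<subseteq> edges G"
      then show ?thesis using C cycle_verts_subset[OF C _ G(1)] by (simp add: cycles_def subgraph_def)
    next
      assume E': "edges C \<subseteq> path_edges p \<union> edges K"
      have "set p \<inter> verts K \<subseteq> {last p}" using K(3) by blast
      from cycle_one_side[OF C E' sp sK this] no_cycle_in_path[OF C p(1)]
      show ?thesis using cycle_verts_subset[OF C _ K(1)] by blast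
    qed
  qed
  show ?thesis
    unfolding extendable_def
  proof (intro allI impI, elim conjE)
    fix L :: "'v \<Rightarrow> nat"
    assume L: "\<forall>u. L u \<le> 2"
      "\<forall>u. L u \<noteq> 0 \<longrightarrow> degree ?J u = 2 \<and> (\<exists>C\<in>cycles ?J. u \<in> verts C)"
    have Lv: "L v = 0"
    proof -
      have "degree ?J v = 3"
        unfolding J using degree_join[OF G(1) H disj y v(1), of v] v(2) by simp
      then show ?thesis using L(2) by (metis numeral_eq_iff semiring_norm(89))
    qed
    \<comment> \<open>A labelled vertex here would lie on a cycle inside \<open>K\<close>, hence be
      \<open>last p\<close>. But there the last path edge is added to two edges of \<open>K\<close>,
      so the degree exceeds 2.\<close>
    have Lp: "L u = 0" if u: "u \<in> set (y # q)" for u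
    proof (rule ccontr)
      assume "L u \<noteq> 0"
      then obtain C where C: "degree ?J u = 2" "C \<in> cycles ?J" "u \<in> verts C" using L(2) by blast
      have "u \<notin> verts G" using u disj by (auto simp: graph_union_def path_graph_def)
      then have "C \<notin> cycles G" using C(3) by (auto simp: cycles_def subgraph_def)
      then have uK: "u \<in> verts K" using cyc[OF C(2)] C(3) by blast
      then have ul: "u = last p" using K(3) u by (auto simp: pq)
      obtain r b where r: "p = r @ [b]" by (metis pq rev_exhaust list.discI)
      have "r \<noteq> []" using p(2) r by auto
      then obtain r' a where r': "r = r' @ [a]" by (metis rev_exhaust)
      have b: "b = u" using ul r by simp
      have "{a, b} \<in> path_edges p" using path_edges_snoc[of r b] unfolding r r' by simp
      then have "{a, b} \<in> edges ?J" by (simp add: graph_union_def path_graph_def)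
      moreover have "a \<notin> verts K" using K(3) p(1) r r' by auto
      then have "{a, b} \<notin> edges K" using simple_edge_subset[OF K(1)] by blast
      moreover have fin: "finite (edges K)" "finite (edges ?J)"
        using simple_finite_edges K(1) simp_J by auto
      ultimately have "Suc (degree K u) = card (insert {a, b} {e \<in> edges K. u \<in> e})"
        unfolding degree_def by simp
      also have "\<dots> \<le> degree ?J u"
        unfolding degree_def
        using fin \<open>{a, b} \<in> edges ?J\<close> b by (intro card_mono) (auto simp: graph_union_def)
      finally show False using degK uK ul C(1) by simp
    qed
    have "last (y # q) = last p" by (simp add: pq)
    then have "colorable n (L(y := 3)) ?H"
      using hang_path[of "y # q" K L n] n(1)[OF L(1)] K(1,3) p(1) Lp by (auto simp: pq)
    moreover have "colorable (card (cycles G)) (L(v := d)) G" if d: "d \<in> {1, 2}" for d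
    proof -
      \<comment> \<open>\<open>extendable\<close> restricts labels on all vertices, so those outside
        \<open>G\<close> are reset to 0.\<close>
      define L1 where "L1 u = (if u \<in> verts G then (L(v := d)) u else 0)" for u
      have "degree G u = 2 \<and> (\<exists>C\<in>cycles G. u \<in> verts C)" if "L1 u \<noteq> 0" for u
      proof (cases "u = v")
        case False
        then have u: "u \<in> verts G" "L u \<noteq> 0" using that by (auto simp: L1_def split: if_splits)
        then obtain C where C: "degree ?J u = 2" "C \<in> cycles ?J" "u \<in> verts C" using L(2) by blast
        have "u \<notin> verts K" using u K(2) by blast
        then have "C \<in> cycles G" using cyc[OF C(2)] C(3) by blast
        moreover have "degree G u = 2"
          using degree_join[OF G(1) H disj y u(1), of v] C(1) False unfolding J by simp
        ultimately show ?thesis using C(3) by blast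
      qed (use v in blast)
      moreover have "\<forall>u. L1 u \<le> 2" using L(1) d by (auto simp: L1_def)
      \<comment> \<open>This supplies the label demanded when \<open>G\<close> is itself a
        cycle.\<close>
      moreover have "L1 v \<noteq> 0" using v(1) d by (auto simp: L1_def)
      ultimately have "colorable (card (cycles G)) L1 G"
        using G(2) unfolding extendable_def by blast
      then show ?thesis by (rule colorable_cong) (simp_all add: L1_def)
    qed
    ultimately have "colorable (card (cycles G) + n) L ?J"
      unfolding J using Lp Lv by (intro colorable_join[OF G(1) H disj v(1) y]) auto
    then show "colorable (card (cycles ?J)) L ?J"
      by (rule colorable_cong) (use n(2) in simp_all)
  qed
qed

lemma T_star_simple_extendable:
  assumes "G \<in> T_star"
  shows "simple G \<and> extendable G"
  using assms
proof induction
  case (cycle C)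
  then show ?case using simple_cycle extendable_cycle by blast
next
  case (add_path G v p)
  \<comment> \<open>A path without a cycle is the case of an empty \<open>K\<close>.\<close>
  let ?K = "\<lparr>verts = {}, edges = {}\<rparr> :: 'a sgraph"
  have K: "simple ?K" by (simp add: simple_def)
  have un: "graph_union H ?K = H" for H by (cases H) (simp add: graph_union_def)
  have G: "simple G" "extendable G" "distinct p" using add_path by blast+
  have s: "simple (graph_union G (path_graph p))"
    by (intro simple_union simple_path G)
  have col: "colorable 0 (L(x := 3)) (graph_union (path_graph [x]) ?K)" for L and x :: 'a
    using colorable_vertex[of L x] unfolding un by (simp add: path_graph_def)
  have "cycles G \<subseteq> cycles (graph_union G (path_graph p))"
    by (auto simp: cycles_def subgraph_def graph_union_def)
  then have "card (cycles G) + 0 \<le> card (cycles (graph_union (graph_union G (path_graph p)) ?K))"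
    unfolding un using card_mono[OF finite_cycles[OF s]] by simp
  then have "extendable (graph_union (graph_union G (path_graph p)) ?K)"
    using add_path.hyps K col by (intro extendable_hang[OF G(1,2), where v = v and n = 0]) simp_all
  then show ?case using s un by simp
next
  case (add_path_cycle G v p C)
  let ?J = "graph_union (graph_union G (path_graph p)) C"
  have G: "simple G" "extendable G" "distinct p" "is_cycle C" using add_path_cycle by blast+
  have C: "simple C" using simple_cycle G(4) .
  have s: "simple ?J"
    by (intro simple_union simple_path C G)
  have lp: "last p \<in> verts C" using add_path_cycle by blast
  then have un: "graph_union (path_graph [last p]) C = C"
    by (cases C) (auto simp: graph_union_def path_graph_def)
  obtain u where "u \<in> verts C" using is_cycle_nonempty[OF G(4)] .
  \<comment> \<open>The new cycle raises the count by one, which pays for its doubled edge.\<close>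
  then have new: "C \<notin> cycles G" using add_path_cycle by (auto simp: cycles_def subgraph_def)
  have "insert C (cycles G) \<subseteq> cycles ?J"
    using G(4) by (auto simp: cycles_def subgraph_def graph_union_def)
  then have "card (insert C (cycles G)) \<le> card (cycles ?J)"
    using card_mono[OF finite_cycles[OF s]] by blast
  then have "card (cycles G) + 1 \<le> card (cycles ?J)"
    using new finite_cycles[OF G(1)] by simp
  moreover have "colorable 1 (L(last p := 3)) (graph_union (path_graph [last p]) C)"
    if "\<forall>u. L u \<le> 2" for L
    unfolding un using cycle_colorable_root[OF G(4) lp] that by blast
  moreover have "2 \<le> degree C (last p)" using cycle_degree[OF G(4) lp] by simp
  ultimately have "extendable ?J"
    using add_path_cycle.hyps C by (intro extendable_hang[OF G(1,2), where v = v and n = 1]) simp_all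
  then show ?case using s by simp
qed

section \<open>From multiplicities to a coloring of the multigraph\<close>

lemma card_bool_Collect: "card {b. Q b} = of_bool (Q True) + of_bool (Q False)"
proof -
  have "{b. Q b} = (if Q True then {True} else {}) \<union> (if Q False then {False} else {})"
    by (auto split: if_splits) (metis (full_types))+
  then show ?thesis by auto
qed

text \<open>The original and the additional copy are numbered 0 and 1, and copies with number below
  \<open>t\<close> receive color 0.\<close>

lemma count_copies:
  fixes t f i :: nat
  assumes "t + f = (if d then 2 else 1)" "i < 2"
  shows "of_bool (d \<and> (if 1 < t then 0 else 1) = i) + of_bool ((if 0 < t then 0 else 1) = i) =
    (if i = 0 then t else f)"
proof -
  have "i = 0 \<or> i = 1" using assms(2) by auto
  moreover have "t = 0 \<or> t = 1 \<or> t = 2" using assms(1) by (cases d) auto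
  ultimately show ?thesis using assms(1) by (cases d; elim disjE; simp)
qed

text \<open>Once no half-edges remain, \<open>wdeg\<close> is the degree in the submultigraph
  induced by a color, with \<open>True\<close> in the role of color 0.\<close>

lemma valid_has_liec:
  assumes G: "simple G" and v: "valid G D W h" and h: "\<forall>c. \<forall>v\<in>verts G. h c v = 0"
  shows "has_liec 2 (double_edges G D)"
proof -
  let ?M = "double_edges G D"
  define c where "c x = (if (if snd x then 1 else 0) < W True (fst x) then 0 else 1::nat)" for x
  have c2: "c x < 2" for x by (simp add: c_def)
  have D: "D \<subseteq> edges G" using v by (auto simp: valid_def matching_def)
  have medges: "(e, b) \<in> medges ?M \<longleftrightarrow> e \<in> edges G \<and> (b \<longrightarrow> e \<in> D)" for e b
    using D by (auto simp: double_edges_def)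
  have card: "card {b. (e, b) \<in> medges ?M \<and> c (e, b) = i} = W (i = 0) e"
    if "e \<in> edges G" "i < 2" for e i
  proof -
    have W: "W True e + W False e = (if e \<in> D then 2 else 1)" using v that(1) unfolding valid_def by blast
    have "W (i = 0) e = (if i = 0 then W True e else W False e)" by simp
    then show ?thesis
      unfolding card_bool_Collect medges c_def fst_conv snd_conv
      using count_copies[OF W that(2)] that(1) by simp
  qed
  have deg: "mdegree (edge_induced ?M {x \<in> medges ?M. c x = i}) u = wdeg G W h (i = 0) u"
    if "u \<in> verts G" "i < 2" for u i
  proof -
    \<comment> \<open>Copies at \<open>u\<close> are grouped by their underlying edge, so that
      counting them gives the sum in \<open>wdeg\<close>.\<close>
    have "{x \<in> medges (edge_induced ?M {x \<in> medges ?M. c x = i}).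
        u \<in> mends (edge_induced ?M {x \<in> medges ?M. c x = i}) x} =
      (SIGMA e:{e \<in> edges G. u \<in> e}. {b. (e, b) \<in> medges ?M \<and> c (e, b) = i})"
      unfolding set_eq_iff split_paired_All mem_Sigma_iff mem_Collect_eq medges
      by (auto simp: edge_induced_def medges) (simp_all add: double_edges_def)
    moreover have "finite {e \<in> edges G. u \<in> e}" using simple_finite_edges[OF G] by simp
    ultimately show ?thesis
      using card that h unfolding mdegree_def wdeg_def by simp
  qed
  have "locally_irregular (edge_induced ?M {x \<in> medges ?M. c x = i})" if i: "i < 2" for i
    unfolding locally_irregular_def
  proof (intro ballI allI impI)
    fix x u w
    assume x: "x \<in> medges (edge_induced ?M {x \<in> medges ?M. c x = i})"
      "mends (edge_induced ?M {x \<in> medges ?M. c x = i}) x = {u, w}"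
    obtain b where xb: "x = ({u, w}, b)"
      using x(2) by (cases x) (auto simp: edge_induced_def double_edges_def)
    have mem: "({u, w}, b) \<in> medges ?M" "c ({u, w}, b) = i"
      using x(1) xb by (auto simp: edge_induced_def)
    then have e: "{u, w} \<in> edges G" using medges by blast
    have "{b. ({u, w}, b) \<in> medges ?M \<and> c ({u, w}, b) = i} \<noteq> {}" using mem by blast
    then have "0 < card {b. ({u, w}, b) \<in> medges ?M \<and> c ({u, w}, b) = i}"
      unfolding card_gt_0_iff by (intro conjI finite)
    then have "0 < W (i = 0) {u, w}" unfolding card[OF e i] .
    then have ne: "wdeg G W h (i = 0) u \<noteq> wdeg G W h (i = 0) w" using v e unfolding valid_def by blast
    have uw: "u \<in> verts G" "w \<in> verts G" using simple_edge_subset[OF G e] by auto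
    show "mdegree (edge_induced ?M {x \<in> medges ?M. c x = i}) u \<noteq>
        mdegree (edge_induced ?M {x \<in> medges ?M. c x = i}) w"
      using ne unfolding deg[OF uw(1) i] deg[OF uw(2) i] .
  qed
  then have "is_liec 2 ?M c" using c2 unfolding is_liec_def by blast
  then show ?thesis unfolding has_liec_def by blast
qed

theorem mainTheorem4:
  fixes G :: "'v sgraph" and k :: nat
  assumes "G \<in> T_star"
    and "\<not> is_cycle G"
    and "k = card (cycles G)"
  shows "\<exists>E_d. matching G E_d \<and> card E_d \<le> k \<and> (\<forall>e\<in>E_d. \<not> pendant G e) \<and>
           has_liec 2 (double_edges G E_d)"
proof -
  have G: "simple G" "extendable G" using T_star_simple_extendable[OF assms(1)] by auto
  \<comment> \<open>The all-zero labelling is admissible because \<open>G\<close> is not a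
    cycle.\<close>
  have "colorable (card (cycles G)) (\<lambda>_. 0) G"
    using G(2) assms(2) unfolding extendable_def by simp
  then obtain D W h where *: "valid G D W h" "card D \<le> card (cycles G)"
    "\<forall>c. \<forall>v\<in>verts G. h c v = 0"
    unfolding colorable_def by (auto simp: half_def)
  have "matching G D" using *(1) unfolding valid_def by blast
  moreover have "\<forall>e\<in>D. \<not> pendant G e"
    using *(1) unfolding valid_def pendant_def by fastforce
  ultimately show ?thesis
    using valid_has_liec[OF G(1) *(1,3)] *(2) assms(3) by blast
qed

end
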